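(* Let $M$ be a $d$-dimensional differentiable manifold, $J: M\to E^N$ an embedding of $M$ into an $N$-dimensional Euclidean space $E^N$ with $J(M)$ closed in $E^N$, and $Q$ a probability measure on $M$. Let $X_1,X_2,\ldots$ be i.i.d. $M$-valued random variables with common distribution $Q$, and put $Y_j=J(X_j)$ and $\bar Y=\frac1n\sum_{j=1}^n Y_j$. Assume that $E|Y_1|^2<\infty$, let $m=EY_1\in E^N$, and assume that the projection $P$ onto $J(M)$ is uniquely defined and continuously differentiable in a neighborhood $V$ of $m$. Then, as $n\to\infty$, $$\sqrt n\, (d_mP)(\bar Y-m)\ \longrightarrow\ N(0,\Sigma)\quad\text{in distribution},$$ where the vector $(d_mP)(\bar Y-m)\in T_{P(m)}J(M)$ is identified with its coordinate vector in $\mathbb R^d$ relative to an orthonormal basis $F_1,\ldots,F_d$ of $T_{P(m)}J(M)$, and $\Sigma=B'CB$. Here $C$ is the $N\times N$ covariance matrix of $Y_1$ and $B=((b_{ji}))_{1\le j\le N,\,1\le i\le d}$ is the $N\times d$ matrix determined by $(d_mP)e_j=\sum_{i=1}^d b_{ji}F_i$ $(j=1,\ldots,N)$, where $e_1,\dots,e_N$ is the standard orthonormal basis of $E^N$.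
   Context: For $y\in V$, $P(y)$ denotes the point of $J(M)$ closest to $y$ in Euclidean distance; "uniquely defined on $V$" means that for each $y\in V$ there is exactly one such closest point. $d_mP: E^N\to T_{P(m)}J(M)$ denotes the differential of $P$ at $m$. A prime denotes matrix transpose, and $N(0,\Sigma)$ is the (possibly degenerate) Gaussian law with mean zero and covariance $\Sigma$. *)

theory Defs
  imports "HOL-Probability.Probability"
begin

section \<open>Maps of class C^k\<close>

text \<open>
  Meant for open \<open>S\<close> and finite-dimensional domains, where continuity of all directional
  derivatives is continuity of the differential.
\<close>

primrec n_times_cont_diff_on ::
  "nat \<Rightarrow> ('a::real_normed_vector \<Rightarrow> 'b::real_normed_vector) \<Rightarrow> 'a set \<Rightarrow> bool" where
  "n_times_cont_diff_on 0 f S \<longleftrightarrow> continuous_on S f"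
| "n_times_cont_diff_on (Suc n) f S \<longleftrightarrow>
     (\<forall>x\<in>S. f differentiable (at x)) \<and>
     (\<forall>v. n_times_cont_diff_on n (\<lambda>x. frechet_derivative f (at x) v) S)"

definition Ck_on ::
  "enat \<Rightarrow> ('a::real_normed_vector \<Rightarrow> 'b::real_normed_vector) \<Rightarrow> 'a set \<Rightarrow> bool" where
  "Ck_on k f S \<longleftrightarrow> (\<forall>n. enat n \<le> k \<longrightarrow> n_times_cont_diff_on n f S)"

section \<open>Manifolds, embeddings, tangent spaces\<close>

text \<open>
  A chart is a pair of its domain and its coordinate map; the values of the coordinate map (and
  below of an embedding) outside the domain are irrelevant.
\<close>

type_synonym ('a, 'd) chart = "'a set \<times> ('a \<Rightarrow> real ^ 'd)"

definition chart_on :: "'a topology \<Rightarrow> ('a, 'd::finite) chart \<Rightarrow> bool" where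
  "chart_on M = (\<lambda>(U, \<phi>). openin M U \<and> open (\<phi> ` U) \<and>
     homeomorphic_map (subtopology M U) (top_of_set (\<phi> ` U)) \<phi>)"

definition Ck_manifold :: "enat \<Rightarrow> 'a topology \<Rightarrow> ('a, 'd::finite) chart set \<Rightarrow> bool" where
  "Ck_manifold k M A \<longleftrightarrow>
     Hausdorff_space M \<and> second_countable M \<and>
     (\<forall>c\<in>A. chart_on M c) \<and> (\<Union>c\<in>A. fst c) = topspace M \<and>
     (\<forall>(U, \<phi>)\<in>A. \<forall>(W, \<psi>)\<in>A. Ck_on k (\<psi> \<circ> inv_into U \<phi>) (\<phi> ` (U \<inter> W)))"

definition Ck_embedding ::
  "enat \<Rightarrow> 'a topology \<Rightarrow> ('a, 'd::finite) chart set \<Rightarrow> ('a \<Rightarrow> real ^ 'n::finite) \<Rightarrow> bool" where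
  "Ck_embedding k M A J \<longleftrightarrow>
     embedding_map M euclidean J \<and>
     (\<forall>(U, \<phi>)\<in>A. Ck_on k (J \<circ> inv_into U \<phi>) (\<phi> ` U) \<and>
        (\<forall>x\<in>U. inj (frechet_derivative (J \<circ> inv_into U \<phi>) (at (\<phi> x)))))"

text \<open>
  \<open>T\<^sub>p J(M) = d\<^sub>x J (T\<^sub>x M)\<close> for \<open>p = J x\<close>, computed in a chart around \<open>x\<close>; by the chain rule all
  charts around \<open>x\<close> contribute the same subspace.
\<close>

definition image_tangent_space ::
  "('a, 'd::finite) chart set \<Rightarrow> ('a \<Rightarrow> real ^ 'n::finite) \<Rightarrow> real ^ 'n \<Rightarrow> (real ^ 'n) set" where
  "image_tangent_space A J p =
     (\<Union>(U, \<phi>)\<in>A. \<Union>x\<in>{x\<in>U. J x = p}. range (frechet_derivative (J \<circ> inv_into U \<phi>) (at (\<phi> x))))"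

definition orthonormal_basis_of :: "('d::finite \<Rightarrow> real ^ 'n::finite) \<Rightarrow> (real ^ 'n) set \<Rightarrow> bool" where
  "orthonormal_basis_of F T \<longleftrightarrow>
     (\<forall>i j. F i \<bullet> F j = (if i = j then 1 else 0)) \<and> span (range F) = T"

definition coord_vec :: "('d::finite \<Rightarrow> real ^ 'n::finite) \<Rightarrow> real ^ 'n \<Rightarrow> real ^ 'd" where
  "coord_vec F v = (THE c. v = (\<Sum>i\<in>UNIV. c $ i *\<^sub>R F i))"

section \<open>The projection onto a subset\<close>

definition unique_closest_point_on :: "(real ^ 'n::finite) set \<Rightarrow> (real ^ 'n) set \<Rightarrow> bool" where
  "unique_closest_point_on S V \<longleftrightarrow> (\<forall>y\<in>V. \<exists>!p. p \<in> S \<and> (\<forall>q\<in>S. dist y p \<le> dist y q))"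

section \<open>Probability\<close>

definition borel_of :: "'a topology \<Rightarrow> 'a measure" where
  "borel_of X = sigma (topspace X) {U. openin X U}"

definition covariance_matrix ::
  "'w measure \<Rightarrow> ('w \<Rightarrow> real ^ 'n::finite) \<Rightarrow> real ^ 'n ^ 'n" where
  "covariance_matrix S Y =
     (\<chi> i j. \<integral>\<omega>. (Y \<omega> $ i - (\<integral>\<omega>. Y \<omega> \<partial>S) $ i) * (Y \<omega> $ j - (\<integral>\<omega>. Y \<omega> \<partial>S) $ j) \<partial>S)"

text \<open>Univariate normal law with mean \<open>\<mu>\<close> and standard deviation \<open>\<sigma> \<ge> 0\<close>.\<close>

definition normal_law :: "real \<Rightarrow> real \<Rightarrow> real measure" where
  "normal_law \<mu> \<sigma> =
     (if \<sigma> = 0 then return borel \<mu> else density lborel (\<lambda>x. ennreal (normal_density \<mu> \<sigma> x)))"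

definition gaussian_law :: "(real ^ 'd::finite) measure \<Rightarrow> bool" where
  "gaussian_law \<nu> \<longleftrightarrow> prob_space \<nu> \<and> sets \<nu> = sets borel \<and>
     (\<forall>t. \<exists>\<mu> \<sigma>. \<sigma> \<ge> 0 \<and> distr \<nu> borel (\<lambda>x. t \<bullet> x) = normal_law \<mu> \<sigma>)"

definition is_multivariate_normal ::
  "(real ^ 'd::finite) measure \<Rightarrow> real ^ 'd \<Rightarrow> real ^ 'd ^ 'd \<Rightarrow> bool" where
  "is_multivariate_normal \<nu> \<mu> \<Sigma> \<longleftrightarrow>
     gaussian_law \<nu> \<and> (\<integral>x. x \<partial>\<nu>) = \<mu> \<and> covariance_matrix \<nu> (\<lambda>x. x) = \<Sigma>"

text \<open>The library's \<open>weak_conv_m\<close> covers only measures on the real line.\<close>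

definition weakly_converges ::
  "(nat \<Rightarrow> 'b::topological_space measure) \<Rightarrow> 'b measure \<Rightarrow> bool" where
  "weakly_converges \<mu> \<nu> \<longleftrightarrow>
     (\<forall>f :: 'b \<Rightarrow> real. continuous_on UNIV f \<and> bounded (range f) \<longrightarrow>
        (\<lambda>n. \<integral>x. f x \<partial>(\<mu> n)) \<longlonglongrightarrow> (\<integral>x. f x \<partial>\<nu>))"

end

theory Submission
  imports Defs
begin

text \<open>
  The differential of \<open>P\<close> at \<open>m\<close> takes values in the tangent space: near \<open>m\<close> the map \<open>P\<close> factors
  through a chart of \<open>J(M)\<close> whose parametrization is an immersion, and any function with values in
  the image of an immersion has its differential in the range of the differential of the immersion.
  Hence the coordinate vector of \<open>\<surd>n (d\<^sub>m P)(Y\<^sub>n - m)\<close>, with \<open>Y\<^sub>n\<close> the sample mean, is \<open>\<surd>n B'(Y\<^sub>n - m)\<close>,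
  a normalized sum of i.i.d. centred vectors with covariance \<open>B'CB\<close>, and the claim is the
  multivariate central limit theorem. By the central limit theorem on the line, the characteristic
  functions converge (the Cramer-Wold device). Since the second moments are bounded, the laws are
  tight, and bounded continuous functions are approximated by trigonometric sums.
\<close>

section \<open>The differential of the projection\<close>

lemma derivative_in_range_of_immersion:
  fixes g :: "'a::euclidean_space \<Rightarrow> 'b::euclidean_space"
    and q :: "'c::real_normed_vector \<Rightarrow> 'b"
  assumes g: "(g has_derivative g') (at (u m))" and inj: "inj g'"
    and q: "(q has_derivative q') (at m)"
    and u: "(u \<longlongrightarrow> u m) (nhds m)"
    and qgu: "\<forall>\<^sub>F y in nhds m. q y = g (u y)"
  shows "q' v \<in> range g'"
proof -
  have lin: "linear g'"
    using g has_derivative_linear by blast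
  obtain c where c: "c > 0" "\<And>h. c * norm h \<le> norm (g' h)"
    using linear_inj_bounded_below_pos[OF lin inj] by auto
  have qm: "q m = g (u m)"
    using qgu eventually_nhds_x_imp_x by blast
  have normal: "z \<bullet> q' v = 0" if z: "\<And>h. z \<bullet> g' h = 0" for z
  proof -
    have "((\<lambda>y. z \<bullet> q y) has_derivative (\<lambda>h. 0)) (at m)"
      unfolding has_derivative_at_alt
    proof (intro conjI allI impI)
      fix e :: real assume e: "e > 0"
      obtain K where K: "K > 0" "\<And>h. norm (q' h) \<le> norm h * K"
        using q has_derivative_bounded_linear bounded_linear.pos_bounded by blast
      define e2 where "e2 = min (c / 2) (e * c / (2 * (norm z + 1) * (K + 1)))"
      have e2: "e2 > 0" "e2 \<le> c / 2" "e2 \<le> e * c / (2 * (norm z + 1) * (K + 1))"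
        unfolding e2_def using c(1) e K(1)
        by (simp_all only: min.cobounded1 min.cobounded2 min_less_iff_conj) (simp add: add_nonneg_pos)
      obtain d where d: "d > 0" "\<And>w. norm (w - u m) < d \<Longrightarrow>
          norm (g w - g (u m) - g' (w - u m)) \<le> e2 * norm (w - u m)"
        using g e2(1) unfolding has_derivative_at_alt by blast
      obtain d1 where d1: "d1 > 0" "\<And>y. norm (y - m) < d1 \<Longrightarrow>
          norm (q y - q m - q' (y - m)) \<le> 1 * norm (y - m)"
        using q zero_less_one unfolding has_derivative_at_alt by blast
      have "\<forall>\<^sub>F y in nhds m. norm (u y - u m) < d"
        using tendstoD[OF u d(1)] by (simp add: dist_norm)
      with qgu have "\<forall>\<^sub>F y in nhds m. q y = g (u y) \<and> norm (u y - u m) < d"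
        by eventually_elim simp
      then obtain d2 where d2: "d2 > 0"
        "\<And>y. dist y m < d2 \<Longrightarrow> q y = g (u y) \<and> norm (u y - u m) < d"
        unfolding eventually_nhds_metric by blast
      have "norm (z \<bullet> q y - z \<bullet> q m - 0) \<le> e * norm (y - m)" if y: "norm (y - m) < min d1 d2" for y
      proof -
        have gy: "q y = g (u y)" "norm (u y - u m) < d"
          using d2(2)[of y] y by (auto simp: dist_norm)
        define h where "h = u y - u m"
        have r: "norm (q y - q m - g' h) \<le> e2 * norm h"
          using d(2)[of "u y"] gy by (simp add: h_def qm)
        have "c * norm h \<le> norm (g' h)"
          by (rule c(2))
        also have "\<dots> \<le> norm (q y - q m) + norm (q y - q m - g' h)"
          by norm
        also have "\<dots> \<le> norm (q y - q m) + c / 2 * norm h"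
          using r mult_right_mono[OF e2(2), of "norm h"] by simp
        finally have h: "norm h \<le> 2 / c * norm (q y - q m)"
          using c(1) by (simp add: field_simps)
        have "norm (q y - q m) \<le> norm (q y - q m - q' (y - m)) + norm (q' (y - m))"
          by norm
        also have "\<dots> \<le> (K + 1) * norm (y - m)"
          using d1(2)[of y] y K(2)[of "y - m"] by (simp add: algebra_simps)
        finally have qy: "norm (q y - q m) \<le> (K + 1) * norm (y - m)" .
        have "norm (z \<bullet> q y - z \<bullet> q m - 0) = \<bar>z \<bullet> (q y - q m - g' h)\<bar>"
          using z by (simp add: inner_diff_right)
        also have "\<dots> \<le> norm z * norm (q y - q m - g' h)"
          by (rule Cauchy_Schwarz_ineq2)
        also have "\<dots> \<le> (norm z + 1) * (e2 * (2 / c * ((K + 1) * norm (y - m))))"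
          by (intro mult_mono order.trans[OF r] mult_left_mono order.trans[OF h])
             (use qy e2(1) c(1) in \<open>auto intro!: mult_left_mono\<close>)
        also have "\<dots> = (e2 * (2 * (norm z + 1) * (K + 1) / c)) * norm (y - m)"
          by (simp add: field_simps)
        also have "\<dots> \<le> e * norm (y - m)"
        proof (rule mult_right_mono)
          have p: "2 * (norm z + 1) * (K + 1) > 0"
            using K(1) by (simp add: add_nonneg_pos)
          then show "e2 * (2 * (norm z + 1) * (K + 1) / c) \<le> e"
            using e2(3) c(1) p by (simp only: pos_le_divide_eq[OF p]) (simp add: field_simps)
        qed simp
        finally show ?thesis .
      qed
      then show "\<exists>d>0. \<forall>y. norm (y - m) < d \<longrightarrow> norm (z \<bullet> q y - z \<bullet> q m - 0) \<le> e * norm (y - m)"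
        using d1(1) d2(1) by (intro exI[of _ "min d1 d2"]) auto
    qed simp
    moreover have "((\<lambda>y. z \<bullet> q y) has_derivative (\<lambda>h. z \<bullet> q' h)) (at m)"
      using q by (auto intro!: derivative_eq_intros)
    ultimately have "(\<lambda>h. z \<bullet> q' h) = (\<lambda>h. 0)"
      by (metis has_derivative_unique)
    then show ?thesis
      by metis
  qed
  have sub: "subspace (range g')"
    by (intro linear_subspace_image lin subspace_UNIV)
  obtain y z where yz: "y \<in> span (range g')" "\<And>w. w \<in> span (range g') \<Longrightarrow> orthogonal z w" "q' v = y + z"
    using orthogonal_subspace_decomp_exists[of "range g'" "q' v"] by metis
  have "z \<bullet> g' h = 0" for h
    using yz(2)[of "g' h"] by (simp add: orthogonal_def span_base)
  then have "z \<bullet> (y + z) = 0"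
    using normal yz(3) by metis
  moreover have "z \<bullet> y = 0"
    using yz(1,2) by (simp add: orthogonal_def)
  ultimately have "z = 0"
    by (simp add: inner_add_right)
  then show ?thesis
    using yz(1,3) sub by (simp add: span_eq_iff[THEN iffD2])
qed

lemma derivative_in_image_tangent_space:
  fixes J :: "'a \<Rightarrow> real ^ 'n::finite" and A :: "('a, 'd::finite) chart set"
  assumes "k \<ge> 1" and M: "Ck_manifold k M A" and emb: "Ck_embedding k M A J"
    and P: "(P has_derivative P') (at m)"
    and PJ: "\<forall>\<^sub>F y in nhds m. P y \<in> J ` topspace M"
  shows "P' v \<in> image_tangent_space A J (P m)"
proof -
  have hJ: "homeomorphic_map M (top_of_set (J ` topspace M)) J"
    using emb by (auto simp: Ck_embedding_def embedding_map_def)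
  then have injJ: "inj_on J (topspace M)"
    by (auto simp: homeomorphic_eq_everything_map)
  obtain x where x: "x \<in> topspace M" "J x = P m"
    using eventually_nhds_x_imp_x[OF PJ] by auto
  obtain U \<phi> where c: "(U, \<phi>) \<in> A" "x \<in> U"
  proof -
    have "x \<in> (\<Union>c\<in>A. fst c)"
      using M x(1) by (simp add: Ck_manifold_def)
    then show ?thesis
      using that by (metis UN_E prod.collapse)
  qed
  have "chart_on M (U, \<phi>)"
    using M c(1) unfolding Ck_manifold_def by blast
  then have U: "openin M U" "open (\<phi> ` U)"
      "homeomorphic_map (subtopology M U) (top_of_set (\<phi> ` U)) \<phi>"
    by (auto simp: chart_on_def)
  have UM: "U \<subseteq> topspace M"
    using U(1) openin_subset by blast
  then have inj\<phi>: "inj_on \<phi> U"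
    using U(3) by (auto simp: homeomorphic_eq_everything_map topspace_subtopology inf_absorb2)
  define u where "u y = \<phi> (inv_into (topspace M) J (P y))" for y
  have near: "\<forall>\<^sub>F y in nhds m. P y \<in> J ` G" if G: "openin M G" "x \<in> G" for G
  proof -
    have "openin (top_of_set (J ` topspace M)) (J ` G)"
      using G(1) openin_subset[OF G(1)] homeomorphic_map_openness[OF hJ] by blast
    then obtain W where W: "open W" "J ` G = J ` topspace M \<inter> W"
      by (auto simp: openin_open)
    have "isCont P m"
      using P has_derivative_continuous by blast
    then have "(P \<longlongrightarrow> P m) (nhds m)"
      by (metis isCont_def tendsto_at_iff_tendsto_nhds)
    moreover have "P m \<in> W"
      using imageI[OF G(2), of J] unfolding W(2) x(2) by simp
    ultimately have "\<forall>\<^sub>F y in nhds m. P y \<in> W"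
      using W(1) topological_tendstoD by blast
    with PJ show ?thesis
      by eventually_elim (use W(2) in blast)
  qed
  have um: "u m = \<phi> x"
    using x injJ by (simp add: u_def flip: x(2))
  define g where "g = J \<circ> inv_into U \<phi>"
  have "P' v \<in> range (frechet_derivative g (at (u m)))"
  proof (rule derivative_in_range_of_immersion[OF _ _ P])
    have "Ck_on k g (\<phi> ` U)"
      using emb c(1) by (auto simp: Ck_embedding_def g_def)
    then have "n_times_cont_diff_on (Suc 0) g (\<phi> ` U)"
      using \<open>k \<ge> 1\<close> by (auto simp: Ck_on_def one_enat_def)
    then have "g differentiable (at (u m))"
      using c(2) um by auto
    then show "(g has_derivative frechet_derivative g (at (u m))) (at (u m))"
      by (simp add: frechet_derivative_works)
    show "inj (frechet_derivative g (at (u m)))"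
      using emb c by (auto simp: Ck_embedding_def g_def um)
    show "(u \<longlongrightarrow> u m) (nhds m)"
    proof (rule topological_tendstoI)
      fix W assume W: "open W" "u m \<in> W"
      let ?G = "{y \<in> topspace (subtopology M U). \<phi> y \<in> \<phi> ` U \<inter> W}"
      have "continuous_map (subtopology M U) (top_of_set (\<phi> ` U)) \<phi>"
        using U(3) homeomorphic_imp_continuous_map by blast
      then have "openin (subtopology M U) ?G"
        by (rule openin_continuous_map_preimage) (use W in auto)
      then have "openin M ?G"
        using U(1) openin_trans_full by blast
      then have "\<forall>\<^sub>F y in nhds m. P y \<in> J ` ?G"
        using near x(1) c(2) W(2) um by auto
      then show "\<forall>\<^sub>F y in nhds m. u y \<in> W"
        by eventually_elim (use injJ in \<open>auto simp: u_def\<close>)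
    qed
    show "\<forall>\<^sub>F y in nhds m. P y = g (u y)"
      using near[OF U(1) c(2)]
      by eventually_elim (use injJ inj\<phi> UM in \<open>auto simp: u_def g_def subset_iff\<close>)
  qed
  then show ?thesis
    using c x by (auto simp: image_tangent_space_def g_def um intro!: bexI[of _ "(U, \<phi>)"] exI[of _ x])
qed

section \<open>Existence of multivariate normal laws\<close>

lemma quadratic_form_diff_axis:
  fixes \<Sigma> :: "real ^ 'd ^ 'd::finite"
  assumes sym: "transpose \<Sigma> = \<Sigma>"
  shows "(t - s *\<^sub>R axis i 1) \<bullet> (\<Sigma> *v (t - s *\<^sub>R axis i 1))
    = t \<bullet> (\<Sigma> *v t) - 2 * s * (\<Sigma> *v t) $ i + s\<^sup>2 * \<Sigma> $ i $ i"
proof -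
  have "t \<bullet> (\<Sigma> *v axis i 1) = (\<Sigma> *v t) $ i"
    using dot_lmul_matrix[of t \<Sigma> "axis i 1"] sym
    by (metis inner_axis inner_real_def mult.right_neutral transpose_matrix_vector)
  moreover have "(\<Sigma> *v axis i 1) $ i = \<Sigma> $ i $ i"
    by (simp add: matrix_vector_mult_basis column_def)
  ultimately show ?thesis
    by (simp add: matrix_vector_mult_diff_distrib matrix_vector_mult_scaleR inner_diff_left
        inner_diff_right inner_axis' algebra_simps power2_eq_square)
qed

lemma psd_matrix_zero_diagonal:
  fixes \<Sigma> :: "real ^ 'd ^ 'd::finite"
  assumes sym: "transpose \<Sigma> = \<Sigma>" and psd: "\<And>t. t \<bullet> (\<Sigma> *v t) \<ge> 0"
    and zero: "\<Sigma> $ i $ i = 0"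
  shows "\<Sigma> $ i $ j = 0"
proof (rule ccontr)
  assume ne: "\<Sigma> $ i $ j \<noteq> 0"
  have "(\<Sigma> *v axis j 1) $ i = \<Sigma> $ i $ j"
    by (simp add: matrix_vector_mult_basis column_def)
  then have "axis j 1 \<bullet> (\<Sigma> *v axis j 1) - 2 * s * \<Sigma> $ i $ j \<ge> 0" for s
    using quadratic_form_diff_axis[OF sym, of "axis j 1" s i] psd[of "axis j 1 - s *\<^sub>R axis i 1"] zero
    by simp
  from this[of "(axis j 1 \<bullet> (\<Sigma> *v axis j 1) + 1) / (2 * \<Sigma> $ i $ j)"] show False
    using ne by simp
qed

text \<open>By Cholesky elimination: each induction step eliminates one pivot of \<open>I\<close>.\<close>

lemma psd_matrix_eq_sum_rank_one:
  fixes \<Sigma> :: "real ^ 'd ^ 'd::finite"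
  assumes "transpose \<Sigma> = \<Sigma>" and "\<And>t. t \<bullet> (\<Sigma> *v t) \<ge> 0"
    and "finite I" and "\<And>i. i \<notin> I \<Longrightarrow> \<Sigma> $ i $ i = 0"
  shows "\<exists>a :: 'd \<Rightarrow> real ^ 'd. \<forall>i j. \<Sigma> $ i $ j = (\<Sum>k\<in>I. a k $ i * a k $ j)"
  using assms(3,1,2,4)
proof (induction I arbitrary: \<Sigma> rule: finite_induct)
  case empty
  then have "\<Sigma> $ i $ j = 0" for i j
    using psd_matrix_zero_diagonal by blast
  then show ?case
    by auto
next
  case (insert x I)
  note qf = quadratic_form_diff_axis[OF insert.prems(1)]
  have sym: "\<Sigma> $ i $ j = \<Sigma> $ j $ i" for i j
    using insert.prems(1) by (metis transpose_def vec_lambda_beta)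
  show ?case
  proof (cases "\<Sigma> $ x $ x = 0")
    case True
    then obtain a where "\<forall>i j. \<Sigma> $ i $ j = (\<Sum>k\<in>I. a k $ i * a k $ j)"
      using insert.IH[OF insert.prems(1,2)] insert.prems(3) by (metis insertE)
    then show ?thesis
      using insert.hyps by (intro exI[of _ "a(x := 0)"]) (auto intro!: sum.cong)
  next
    case False
    define p where "p = \<Sigma> $ x $ x"
    have "axis x 1 \<bullet> (\<Sigma> *v axis x 1) = p"
      by (simp add: matrix_vector_mult_basis column_def inner_axis' p_def)
    then have p: "p > 0"
      using insert.prems(2)[of "axis x 1"] False p_def by simp
    define \<Sigma>' :: "real ^ 'd ^ 'd" where "\<Sigma>' = (\<chi> i j. \<Sigma> $ i $ j - \<Sigma> $ i $ x * \<Sigma> $ j $ x / p)"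
    have "\<exists>a :: 'd \<Rightarrow> real ^ 'd. \<forall>i j. \<Sigma>' $ i $ j = (\<Sum>k\<in>I. a k $ i * a k $ j)"
    proof (rule insert.IH)
      show "transpose \<Sigma>' = \<Sigma>'"
        using sym by (simp add: \<Sigma>'_def transpose_def vec_eq_iff mult.commute)
      show "\<Sigma>' $ i $ i = 0" if "i \<notin> I" for i
        using that insert.prems(3)[of i] psd_matrix_zero_diagonal[OF insert.prems(1,2), of i x] p
        by (cases "i = x") (auto simp: \<Sigma>'_def p_def)
      show "0 \<le> t \<bullet> (\<Sigma>' *v t)" for t
      proof -
        define r where "r = (\<Sigma> *v t) $ x"
        have r: "(\<Sum>j\<in>UNIV. \<Sigma> $ j $ x * t $ j) = r"
          using sym by (simp add: r_def matrix_vector_mult_def)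
        have "(\<Sigma>' *v t) $ i = (\<Sigma> *v t) $ i - \<Sigma> $ i $ x * r / p" for i
          by (simp add: matrix_vector_mult_def \<Sigma>'_def algebra_simps sum_subtractf
              flip: r) (simp add: sum_distrib_left sum_divide_distrib mult_ac)
        then have "t \<bullet> (\<Sigma>' *v t) = t \<bullet> (\<Sigma> *v t) - (\<Sum>i\<in>UNIV. t $ i * (\<Sigma> $ i $ x * r / p))"
          by (simp only: inner_vec_def inner_real_def right_diff_distrib sum_subtractf)
        also have "(\<Sum>i\<in>UNIV. t $ i * (\<Sigma> $ i $ x * r / p)) = (\<Sum>j\<in>UNIV. \<Sigma> $ j $ x * t $ j) * r / p"
          by (simp only: sum_distrib_right sum_divide_distrib) (simp add: mult_ac)
        also have "\<dots> = r * r / p"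
          by (simp only: r)
        also have "t \<bullet> (\<Sigma> *v t) - r * r / p = (t - (r / p) *\<^sub>R axis x 1) \<bullet> (\<Sigma> *v (t - (r / p) *\<^sub>R axis x 1))"
          unfolding qf using p by (simp add: field_simps power2_eq_square flip: r_def p_def)
        also have "\<dots> \<ge> 0"
          by (rule insert.prems(2))
        finally show ?thesis .
      qed
    qed
    then obtain a where a: "\<And>i j. \<Sigma>' $ i $ j = (\<Sum>k\<in>I. a k $ i * a k $ j)"
      by auto
    define b :: "real ^ 'd" where "b = (\<chi> i. \<Sigma> $ i $ x / sqrt p)"
    have "\<Sigma> $ i $ j = b $ i * b $ j + (\<Sum>k\<in>I. a k $ i * a k $ j)" for i j
      using p by (simp add: b_def \<Sigma>'_def flip: a)
    then show ?thesis
      using insert.hyps by (intro exI[of _ "a(x := b)"]) (auto intro!: sum.cong)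
  qed
qed

lemma normal_law_zero_mean:
  assumes "\<sigma> \<ge> 0"
  shows "normal_law 0 \<sigma> = distr std_normal_distribution borel (\<lambda>x. \<sigma> * x)"
proof (cases "\<sigma> = 0")
  case True
  interpret real_distribution std_normal_distribution
    by (rule real_dist_normal_dist)
  have "distr std_normal_distribution borel (\<lambda>x. 0) = return borel (0::real)"
    by (intro measure_eqI) (auto simp: emeasure_distr indicator_def emeasure_space_1[simplified])
  then show ?thesis
    by (simp add: True normal_law_def)
next
  case False
  interpret real_distribution std_normal_distribution
    by (rule real_dist_normal_dist)
  have "distributed std_normal_distribution lborel (\<lambda>x. x) (normal_density 0 1)"
    by (auto simp: distributed_def distr_id2)
  from normal_density_affine[OF this, of \<sigma> 0] False assms
  have "distributed std_normal_distribution lborel (\<lambda>x. \<sigma> * x) (normal_density 0 \<sigma>)"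
    by simp
  then have "distr std_normal_distribution lborel (\<lambda>x. \<sigma> * x) = density lborel (normal_density 0 \<sigma>)"
    by (rule distributed_distr_eq_density)
  then show ?thesis
    using False by (simp add: normal_law_def cong: distr_cong)
qed

lemma multivariate_normal_exists:
  fixes \<Sigma> :: "real ^ 'd ^ 'd::finite"
  assumes sym: "transpose \<Sigma> = \<Sigma>" and psd: "\<And>t. t \<bullet> (\<Sigma> *v t) \<ge> 0"
  obtains \<nu> where "is_multivariate_normal \<nu> 0 \<Sigma>"
    and "\<And>t. distr \<nu> borel (\<lambda>x. t \<bullet> x) = normal_law 0 (sqrt (t \<bullet> (\<Sigma> *v t)))"
proof -
  interpret std: real_distribution std_normal_distribution
    by (rule real_dist_normal_dist)
  have char_scaled: "char (distr std_normal_distribution borel (\<lambda>x. c * x)) s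
      = exp (- ((s * c)\<^sup>2) / 2)" for c s
    using fun_cong[OF char_std_normal_distribution, of "s * c"]
    by (simp add: char_def integral_distr mult.assoc)
  obtain a :: "'d \<Rightarrow> real ^ 'd" where a: "\<And>i j. \<Sigma> $ i $ j = (\<Sum>k\<in>UNIV. a k $ i * a k $ j)"
    using psd_matrix_eq_sum_rank_one[OF assms, of UNIV] by auto
  define q where "q t = t \<bullet> (\<Sigma> *v t)" for t
  have q: "q t = (\<Sum>k\<in>UNIV. (t \<bullet> a k)\<^sup>2)" for t
  proof -
    have "q t = (\<Sum>i\<in>UNIV. \<Sum>j\<in>UNIV. \<Sum>k\<in>UNIV. (t $ i * a k $ i) * (t $ j * a k $ j))"
      by (simp add: q_def inner_vec_def matrix_vector_mult_def a sum_distrib_left sum_distrib_right mult_ac)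
    also have "\<dots> = (\<Sum>k\<in>UNIV. \<Sum>i\<in>UNIV. \<Sum>j\<in>UNIV. (t $ i * a k $ i) * (t $ j * a k $ j))"
      by (subst sum.swap[of _ UNIV UNIV], subst sum.swap[of _ UNIV UNIV])
         (intro sum.cong refl sum.swap)
    also have "\<dots> = (\<Sum>k\<in>UNIV. (t \<bullet> a k)\<^sup>2)"
      by (simp add: inner_vec_def power2_eq_square sum_product)
    finally show ?thesis .
  qed
  define N where "N = (\<Pi>\<^sub>M k\<in>(UNIV::'d set). std_normal_distribution)"
  interpret N: prob_space N
    unfolding N_def by (intro prob_space_PiM std.prob_space_axioms)
  have coord [measurable]: "(\<lambda>\<omega>. \<omega> k) \<in> borel_measurable N" for k
    unfolding N_def by measurable
  define \<nu> where "\<nu> = distr N borel (\<lambda>\<omega>. \<Sum>k\<in>UNIV. \<omega> k *\<^sub>R a k)"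
  interpret \<nu>: prob_space \<nu>
    unfolding \<nu>_def by (intro N.prob_space_distr) measurable
  have sets_\<nu> [measurable_cong, simp]: "sets \<nu> = sets borel"
    by (simp add: \<nu>_def)
  have distr_coord: "distr N borel (\<lambda>\<omega>. \<omega> k) = std_normal_distribution" for k
    using distr_PiM_component[of UNIV "\<lambda>_. std_normal_distribution" k] std.prob_space_axioms
    by (simp add: N_def cong: distr_cong)
  have indep: "N.indep_vars (\<lambda>_. borel) (\<lambda>k \<omega>. \<omega> k) UNIV"
  proof (subst N.indep_vars_iff_distr_eq_PiM)
    have "distr N (\<Pi>\<^sub>M i\<in>UNIV. borel) (\<lambda>x. \<lambda>i\<in>UNIV. x i) = distr N N (\<lambda>x. x)"
      by (intro distr_cong) (auto simp: N_def intro!: sets_PiM_cong)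
    then show "distr N (\<Pi>\<^sub>M i\<in>UNIV. borel) (\<lambda>x. \<lambda>i\<in>UNIV. x i) = (\<Pi>\<^sub>M i\<in>UNIV. distr N borel (\<lambda>x. x i))"
      by (simp add: distr_coord flip: N_def)
  qed auto
  have marg: "distr \<nu> borel (\<lambda>x. t \<bullet> x) = normal_law 0 (sqrt (q t))" for t
  proof (rule Levy_uniqueness)
    have "distr \<nu> borel (\<lambda>x. t \<bullet> x) = distr N borel (\<lambda>\<omega>. \<Sum>k\<in>UNIV. (t \<bullet> a k) * \<omega> k)"
      by (simp add: \<nu>_def distr_distr comp_def inner_sum_right mult.commute)
    moreover have "char (distr N borel (\<lambda>\<omega>. \<Sum>k\<in>UNIV. (t \<bullet> a k) * \<omega> k)) s
        = char (normal_law 0 (sqrt (q t))) s" for s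
    proof -
      have "char (distr N borel (\<lambda>\<omega>. \<Sum>k\<in>UNIV. (t \<bullet> a k) * \<omega> k)) s
          = (\<Prod>k\<in>UNIV. char (distr N borel (\<lambda>\<omega>. (t \<bullet> a k) * \<omega> k)) s)"
        by (intro N.char_distr_sum N.indep_vars_compose2[OF indep]) auto
      also have "\<dots> = (\<Prod>k\<in>UNIV. char (distr (distr N borel (\<lambda>\<omega>. \<omega> k)) borel (\<lambda>x. (t \<bullet> a k) * x)) s)"
        by (simp add: distr_distr comp_def)
      also have "\<dots> = (\<Prod>k\<in>UNIV. complex_of_real (exp (- ((s * (t \<bullet> a k))\<^sup>2) / 2)))"
        by (simp add: distr_coord char_scaled)
      also have "\<dots> = exp (\<Sum>k\<in>UNIV. - ((s * (t \<bullet> a k))\<^sup>2) / 2)"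
        by (simp add: exp_sum)
      also have "(\<Sum>k\<in>UNIV. - ((s * (t \<bullet> a k))\<^sup>2) / 2) = - ((s * sqrt (q t))\<^sup>2) / 2"
        using psd[of t] by (simp add: q_def[symmetric]) 
           (simp add: q power_mult_distrib sum_negf sum_distrib_left flip: sum_divide_distrib)
      also have "exp \<dots> = char (normal_law 0 (sqrt (q t))) s"
        using psd[of t] by (simp add: normal_law_zero_mean char_scaled q_def)
      finally show ?thesis .
    qed
    ultimately show "char (distr \<nu> borel (\<lambda>x. t \<bullet> x)) = char (normal_law 0 (sqrt (q t)))"
      by auto
    show "real_distribution (distr \<nu> borel (\<lambda>x. t \<bullet> x))"
      by (intro \<nu>.real_distribution_distr) simp
    show "real_distribution (normal_law 0 (sqrt (q t)))"
      using psd[of t] by (auto simp: normal_law_zero_mean q_def intro: std.real_distribution_distr)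
  qed
  have marg_std: "distr \<nu> borel (\<lambda>x. t \<bullet> x) = distr std_normal_distribution borel (\<lambda>x. sqrt (q t) * x)" for t
    using psd[of t] by (simp add: marg normal_law_zero_mean q_def)
  have std_moments: "integrable std_normal_distribution (\<lambda>x. x)" "(LINT x|std_normal_distribution. x) = 0"
      "integrable std_normal_distribution (\<lambda>x. x\<^sup>2)" "(LINT x|std_normal_distribution. x\<^sup>2) = 1"
    using integrable_std_normal_distribution_moment[of 1] integral_std_normal_distribution_moment_odd[of 1]
      std_normal_distribution_even_moments[of 1] by (simp_all only: power_one_right) (simp_all add: fact_numeral)
  have transfer: "integrable \<nu> (\<lambda>x. h (t \<bullet> x)) \<longleftrightarrow> integrable std_normal_distribution (\<lambda>x. h (sqrt (q t) * x))"
    "(\<integral>x. h (t \<bullet> x) \<partial>\<nu>) = (LINT x|std_normal_distribution. h (sqrt (q t) * x))"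
    if [measurable]: "h \<in> borel_measurable borel" for h :: "real \<Rightarrow> real" and t
  proof -
    have 1: "(\<lambda>x. t \<bullet> x) \<in> borel_measurable \<nu>" "(\<lambda>x. sqrt (q t) * x) \<in> borel_measurable std_normal_distribution"
      by simp_all
    show "integrable \<nu> (\<lambda>x. h (t \<bullet> x)) \<longleftrightarrow> integrable std_normal_distribution (\<lambda>x. h (sqrt (q t) * x))"
      using integrable_distr_eq[OF 1(1) that] integrable_distr_eq[OF 1(2) that] marg_std by metis
    show "(\<integral>x. h (t \<bullet> x) \<partial>\<nu>) = (LINT x|std_normal_distribution. h (sqrt (q t) * x))"
      using integral_distr[OF 1(1) that] integral_distr[OF 1(2) that] marg_std by metis
  qed
  have moment1: "integrable \<nu> (\<lambda>x. t \<bullet> x)" "(\<integral>x. t \<bullet> x \<partial>\<nu>) = 0" for t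
    using std_moments(2) by (simp_all only: transfer[of "\<lambda>x. x"] measurable_ident_sets
        integral_mult_right_zero integrable_mult_right[OF std_moments(1)] mult_zero_right)
  have moment2: "integrable \<nu> (\<lambda>x. (t \<bullet> x)\<^sup>2)" "(\<integral>x. (t \<bullet> x)\<^sup>2 \<partial>\<nu>) = q t" for t
  proof -
    have sq: "(\<lambda>x::real. x\<^sup>2) \<in> borel_measurable borel"
      by measurable
    show "integrable \<nu> (\<lambda>x. (t \<bullet> x)\<^sup>2)"
      unfolding transfer(1)[OF sq] power_mult_distrib by (intro integrable_mult_right std_moments(3))
    show "(\<integral>x. (t \<bullet> x)\<^sup>2 \<partial>\<nu>) = q t"
      unfolding transfer(2)[OF sq] power_mult_distrib integral_mult_right_zero std_moments(4)
      using psd[of t] by (simp add: q_def)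
  qed
  have "integrable \<nu> (\<lambda>x. x \<bullet> b)" for b
    using moment1(1)[of b] by (simp only: inner_commute)
  then have "integrable \<nu> (\<lambda>x. \<Sum>b\<in>Basis. (x \<bullet> b) *\<^sub>R b)"
    by (auto intro!: Bochner_Integration.integrable_sum integrable_scaleR_left)
  then have int_id: "integrable \<nu> (\<lambda>x. x)"
    by (simp add: euclidean_representation)
  have mean: "(\<integral>x. x \<partial>\<nu>) = 0"
  proof -
    have "t \<bullet> (\<integral>x. x \<partial>\<nu>) = 0" for t
      using moment1(2)[of t] int_id by simp
    then show ?thesis
      by (metis inner_eq_zero_iff)
  qed
  have "covariance_matrix \<nu> (\<lambda>x. x) $ i $ j = \<Sigma> $ i $ j" for i j
  proof -
    let ?p = "axis i 1 + axis j 1 :: real ^ 'd" and ?m = "axis i 1 - axis j 1 :: real ^ 'd"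
    have "covariance_matrix \<nu> (\<lambda>x. x) $ i $ j = (\<integral>x. ((?p \<bullet> x)\<^sup>2 - (?m \<bullet> x)\<^sup>2) / 4 \<partial>\<nu>)"
      unfolding covariance_matrix_def
      by (simp add: mean inner_add_left inner_diff_left inner_axis' power2_eq_square algebra_simps)
    also have "\<dots> = (q ?p - q ?m) / 4"
      using moment2 by simp
    also have "\<dots> = \<Sigma> $ i $ j"
    proof -
      have e: "axis i 1 \<bullet> (\<Sigma> *v axis j 1) = \<Sigma> $ i $ j" for i j
        by (simp add: matrix_vector_mult_basis column_def inner_axis')
      have "\<Sigma> $ j $ i = \<Sigma> $ i $ j"
        by (simp add: a mult.commute)
      then show ?thesis
        by (simp add: q_def matrix_vector_right_distrib matrix_vector_mult_diff_distrib
            inner_add_left inner_diff_left inner_add_right inner_diff_right e)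
    qed
    finally show ?thesis .
  qed
  then have "is_multivariate_normal \<nu> 0 \<Sigma>"
    unfolding is_multivariate_normal_def gaussian_law_def
    using \<nu>.prob_space_axioms mean marg psd q_def by (auto simp: vec_eq_iff) (metis real_sqrt_ge_zero)
  then show ?thesis
    using that marg by (simp add: q_def)
qed

section \<open>Weak convergence from characteristic functions\<close>

inductive trig_sum :: "('b::real_inner \<Rightarrow> complex) \<Rightarrow> bool" where
  iexp: "trig_sum (\<lambda>x. c * iexp (t \<bullet> x))"
| add: "trig_sum g \<Longrightarrow> trig_sum h \<Longrightarrow> trig_sum (\<lambda>x. g x + h x)"

lemma trig_sum_const: "trig_sum (\<lambda>x. c)"
  using trig_sum.iexp[of c 0] by simp

lemma trig_sum_mult:
  assumes "trig_sum g" "trig_sum h"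
  shows "trig_sum (\<lambda>x. g x * h x)"
  using assms
proof (induction arbitrary: h rule: trig_sum.induct)
  case (iexp c t)
  from iexp.prems show ?case
  proof (induction rule: trig_sum.induct)
    case (iexp c' t')
    have "(\<lambda>x. c * iexp (t \<bullet> x) * (c' * iexp (t' \<bullet> x))) = (\<lambda>x. (c * c') * iexp ((t + t') \<bullet> x))"
      by (simp add: inner_add_left exp_add distrib_left mult_ac)
    then show ?case
      using trig_sum.iexp[of "c * c'" "t + t'"] by simp
  next
    case (add g h)
    from trig_sum.add[OF add.IH] show ?case
      by (simp add: distrib_left)
  qed
next
  case (add g g')
  from trig_sum.add[OF add.IH(1)[OF add.prems] add.IH(2)[OF add.prems]] show ?case
    by (simp add: distrib_right)
qed

lemma trig_sum_sum:
  assumes "finite I" "\<And>i. i \<in> I \<Longrightarrow> trig_sum (g i)"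
  shows "trig_sum (\<lambda>x. \<Sum>i\<in>I. g i x)"
  using assms by (induction I rule: finite_induct) (auto intro: trig_sum_const trig_sum.add)

lemma trig_sum_sin: "trig_sum (\<lambda>x. complex_of_real (sin (t \<bullet> x)))"
proof -
  have "complex_of_real (sin (t \<bullet> x)) = (- \<i> / 2) * iexp (t \<bullet> x) + (\<i> / 2) * iexp ((- t) \<bullet> x)" for x
    by (simp add: sin_of_real[symmetric] sin_exp_eq del: sin_of_real) (simp add: field_simps)
  then show ?thesis
    using trig_sum.add[OF trig_sum.iexp trig_sum.iexp, of "- \<i> / 2" t "\<i> / 2" "- t"] by simp
qed

lemma trig_sum_polynomial_sin:
  fixes p :: "real ^ 'd::finite \<Rightarrow> real"
  assumes "real_polynomial_function p"
  shows "trig_sum (\<lambda>x. complex_of_real (p (\<chi> i. sin (x $ i / L))))"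
  using assms
proof (induction rule: real_polynomial_function.induct)
  case (linear f)
  interpret bounded_linear f
    by (rule linear)
  have expand: "f s = (\<Sum>i\<in>UNIV. s $ i * f (axis i 1))" for s
  proof -
    have "f s = f (\<Sum>i\<in>UNIV. s $ i *\<^sub>R axis i 1)"
      using basis_expansion[of s] by (simp add: scalar_mult_eq_scaleR)
    then show ?thesis
      by (simp add: sum scaleR)
  qed
  have "(\<lambda>x. complex_of_real (f (\<chi> i. sin (x $ i / L)))) =
      (\<lambda>x. \<Sum>i\<in>UNIV. complex_of_real (sin (axis i (1 / L) \<bullet> x)) * complex_of_real (f (axis i 1)))"
    by (subst expand) (simp add: inner_axis')
  then show ?case
    by (simp only:) (intro trig_sum_sum trig_sum_mult trig_sum_sin trig_sum_const finite_class.finite_UNIV)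
next
  case (const c)
  show ?case
    by (rule trig_sum_const)
next
  case (add f g)
  then show ?case
    by (simp add: trig_sum.add)
next
  case (mult f g)
  then show ?case
    by (simp add: trig_sum_mult)
qed

lemma trig_sum_integrable:
  fixes h :: "'b::euclidean_space \<Rightarrow> complex"
  assumes "trig_sum h" "prob_space M" "sets M = sets borel"
  shows "integrable M h"
  using assms(1)
proof (induction rule: trig_sum.induct)
  case (iexp c t)
  interpret prob_space M
    by fact
  note [measurable_cong] = assms(3)
  have "integrable M (\<lambda>x. iexp (t \<bullet> x))"
    by (rule integrable_iexp) auto
  then show ?case
    by simp
qed auto

lemma trig_sum_integral_tendsto:
  fixes h :: "'b::euclidean_space \<Rightarrow> complex"
  assumes "trig_sum h"
    and "\<And>n. prob_space (\<mu> n)" "\<And>n. sets (\<mu> n) = sets borel"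
    and "prob_space \<nu>" "sets \<nu> = sets borel"
    and char: "\<And>t. (\<lambda>n. CLINT x|\<mu> n. iexp (t \<bullet> x)) \<longlonglongrightarrow> (CLINT x|\<nu>. iexp (t \<bullet> x))"
  shows "(\<lambda>n. CLINT x|\<mu> n. h x) \<longlonglongrightarrow> (CLINT x|\<nu>. h x)"
  using assms(1)
proof (induction rule: trig_sum.induct)
  case (iexp c t)
  then show ?case
    using tendsto_mult_left[OF char] by simp
next
  case (add g h)
  then show ?case
    using tendsto_add[OF add.IH] by (simp add: trig_sum_integrable assms)
qed

text \<open>
  The function \<open>x \<mapsto> R arcsin (sin (x / R))\<close>, applied in each coordinate, is the identity on the ball of
  radius \<open>R\<close> and makes every continuous function a continuous function of the sines of the
  coordinates. Its polynomial approximation is therefore a trigonometric sum which is uniformly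
  close on the ball and bounded everywhere.
\<close>

lemma trig_approximation:
  fixes f :: "real ^ 'd::finite \<Rightarrow> real"
  assumes f: "continuous_on UNIV f" and b: "\<And>x. \<bar>f x\<bar> \<le> b" and R: "R > 0" and e: "e > 0"
  obtains g where "trig_sum (\<lambda>x. complex_of_real (g x))"
    and "\<And>x. norm x \<le> R \<Longrightarrow> \<bar>f x - g x\<bar> \<le> e"
    and "\<And>x. \<bar>g x\<bar> \<le> b + e"
proof -
  define H where "H s = f (\<chi> i. R * arcsin (s $ i))" for s :: "real ^ 'd"
  let ?S = "cbox (\<chi> i. -1) (\<chi> i. 1) :: (real ^ 'd) set"
  have "continuous_on ?S H"
    unfolding H_def
    by (intro continuous_on_compose2[OF f] continuous_on_vec_lambda continuous_intros)
       (auto simp: mem_box_cart)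
  then obtain p where p: "real_polynomial_function p" "\<And>s. s \<in> ?S \<Longrightarrow> \<bar>H s - p s\<bar> < e"
    using Stone_Weierstrass_real_polynomial_function[OF compact_cbox _ e] by blast
  define s :: "real ^ 'd \<Rightarrow> real ^ 'd" where "s x = (\<chi> i. sin (x $ i / R))" for x
  have s: "\<bar>H (s x) - p (s x)\<bar> < e" for x
    by (rule p(2)) (simp add: s_def mem_box_cart)
  show ?thesis
  proof (rule that[of "\<lambda>x. p (s x)"])
    show "trig_sum (\<lambda>x. complex_of_real (p (s x)))"
      unfolding s_def by (rule trig_sum_polynomial_sin[OF p(1)])
    show "\<bar>p (s x)\<bar> \<le> b + e" for x
      using s[of x] b[of "\<chi> i. R * arcsin (s x $ i)"] by (simp add: H_def)
    show "\<bar>f x - p (s x)\<bar> \<le> e" if x: "norm x \<le> R" for x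
    proof -
      have "R * arcsin (s x $ i) = x $ i" for i
      proof -
        have "\<bar>x $ i / R\<bar> \<le> 1"
          using R x component_le_norm_cart[of x i] by simp
        then have "arcsin (sin (x $ i / R)) = x $ i / R"
          using pi_ge_two by (intro arcsin_sin) linarith+
        then show ?thesis
          using R by (simp add: s_def)
      qed
      then have "H (s x) = f x"
        by (simp add: H_def)
      then show ?thesis
        using s[of x] by simp
    qed
  qed
qed

lemma integral_diff_le_tail:
  fixes f g :: "'b::euclidean_space \<Rightarrow> real"
  assumes "prob_space M" and [measurable_cong]: "sets M = sets borel"
    and f: "integrable M f" and g: "integrable M g"
    and in_ball: "\<And>x. norm x \<le> R \<Longrightarrow> \<bar>f x - g x\<bar> \<le> e"
    and everywhere: "\<And>x. \<bar>f x - g x\<bar> \<le> K" and "e \<ge> 0"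
  shows "\<bar>(\<integral>x. f x \<partial>M) - (\<integral>x. g x \<partial>M)\<bar> \<le> e + K * measure M {x. norm x > R}"
proof -
  interpret prob_space M
    by fact
  have sp: "space M = UNIV"
    using sets_eq_imp_space_eq[OF assms(2)] by simp
  have [measurable]: "{x. norm x > R} \<in> sets M"
    by measurable
  have "\<bar>(\<integral>x. f x \<partial>M) - (\<integral>x. g x \<partial>M)\<bar> = \<bar>\<integral>x. f x - g x \<partial>M\<bar>"
    using f g by simp
  also have "\<dots> \<le> (\<integral>x. \<bar>f x - g x\<bar> \<partial>M)"
    by (rule integral_abs_bound)
  also have "\<dots> \<le> (\<integral>x. e + K * indicator {x. norm x > R} x \<partial>M)"
  proof (rule integral_mono)
    show "\<bar>f x - g x\<bar> \<le> e + K * indicator {x. norm x > R} x" for x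
      using in_ball[of x] everywhere[of x] \<open>e \<ge> 0\<close> by (auto simp: indicator_def)
  qed (use f g in \<open>auto simp: emeasure_eq_measure\<close>)
  also have "\<dots> = e + K * measure M {x. norm x > R}"
    using prob_space by (simp add: sp emeasure_eq_measure)
  finally show ?thesis .
qed

lemma prob_norm_tail:
  fixes M :: "'b::euclidean_space measure"
  assumes "prob_space M" and [measurable_cong]: "sets M = sets borel" and "e > 0"
  obtains R where "R > 0" "measure M {x. norm x > R} \<le> e"
proof -
  interpret prob_space M
    by fact
  have "(\<lambda>n. measure M {x. norm x > real n}) \<longlonglongrightarrow> measure M (\<Inter>n. {x. norm x > real n})"
    by (rule finite_Lim_measure_decseq) (auto simp: decseq_def)
  moreover have "(\<Inter>n. {x::'b. norm x > real n}) = {}"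
    by auto (meson reals_Archimedean2 less_asym)
  ultimately have "(\<lambda>n. measure M {x. norm x > real n}) \<longlonglongrightarrow> 0"
    by simp
  then have "\<forall>\<^sub>F n in sequentially. measure M {x. norm x > real n} < e"
    using \<open>e > 0\<close> by (rule order_tendstoD)
  then have "\<forall>\<^sub>F n in sequentially. measure M {x. norm x > real n} < e \<and> n > 0"
    by (intro eventually_conj eventually_gt_at_top)
  then obtain n where "measure M {x. norm x > real n} < e" "n > 0"
    using eventually_happens'[OF sequentially_bot] by blast
  then show ?thesis
    using that[of "real n"] by simp
qed

lemma weakly_converges_if_char_tendsto:
  fixes \<mu> :: "nat \<Rightarrow> (real ^ 'd::finite) measure"
  assumes \<mu>: "\<And>n. prob_space (\<mu> n)" "\<And>n. sets (\<mu> n) = sets borel"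
    and \<nu>: "prob_space \<nu>" "sets \<nu> = sets borel"
    and char: "\<And>t. (\<lambda>n. CLINT x|\<mu> n. iexp (t \<bullet> x)) \<longlonglongrightarrow> (CLINT x|\<nu>. iexp (t \<bullet> x))"
    and tight: "\<And>e. e > 0 \<Longrightarrow> \<exists>R. \<forall>n. measure (\<mu> n) {x. norm x > R} \<le> e"
  shows "weakly_converges \<mu> \<nu>"
  unfolding weakly_converges_def
proof (intro allI impI)
  fix f :: "real ^ 'd \<Rightarrow> real"
  assume "continuous_on UNIV f \<and> bounded (range f)"
  then have f: "continuous_on UNIV f" and "bounded (range f)"
    by auto
  then obtain b where b: "\<And>x. \<bar>f x\<bar> \<le> b"
    by (auto simp: bounded_iff)
  then have b0: "b \<ge> 0"
    using abs_ge_zero order_trans by blast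
  have f_int: "integrable M f" if "prob_space M" "sets M = sets borel" for M
  proof -
    interpret prob_space M
      by fact
    note [measurable_cong] = that(2)
    have [measurable]: "f \<in> borel_measurable borel"
      using f by (rule borel_measurable_continuous_onI)
    show ?thesis
      using b by (intro integrable_const_bound[of _ b]) auto
  qed
  show "(\<lambda>n. \<integral>x. f x \<partial>\<mu> n) \<longlonglongrightarrow> (\<integral>x. f x \<partial>\<nu>)"
  proof (rule LIMSEQ_I)
    fix r :: real
    assume "r > 0"
    define e where "e = min 1 (r / (2 * (2 * b + 3)))"
    have e: "e > 0" "e \<le> 1" "e * (2 * (2 * b + 3)) \<le> r"
    proof -
      have "0 < 2 * (2 * b + 3)"
        using b0 by simp
      then show "e > 0" "e \<le> 1" "e * (2 * (2 * b + 3)) \<le> r"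
        using \<open>r > 0\<close> by (simp_all only: e_def pos_le_divide_eq[symmetric] min.cobounded2 min.cobounded1)
          (simp add: b0)
    qed
    obtain R1 where R1: "R1 > 0" "measure \<nu> {x. norm x > R1} \<le> e"
      using prob_norm_tail[OF \<nu> e(1)] .
    obtain R2 where R2: "\<And>n. measure (\<mu> n) {x. norm x > R2} \<le> e"
      using tight[OF e(1)] by blast
    define R where "R = max R1 R2"
    have R: "R > 0"
      using R1 by (simp add: R_def)
    have shrink: "measure M {x. norm x > R} \<le> e"
      if "prob_space M" "sets M = sets borel" "measure M {x. norm x > R'} \<le> e" "R' \<le> R" 
      for M :: "(real ^ 'd) measure" and R'
    proof -
      interpret prob_space M
        by fact
      note [measurable_cong] = that(2)
      have "measure M {x. norm x > R} \<le> measure M {x. norm x > R'}"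
        by (rule finite_measure_mono) (use that in auto)
      then show ?thesis
        using that by simp
    qed
    obtain g where g: "trig_sum (\<lambda>x. complex_of_real (g x))"
        "\<And>x. norm x \<le> R \<Longrightarrow> \<bar>f x - g x\<bar> \<le> e" "\<And>x. \<bar>g x\<bar> \<le> b + e"
      using trig_approximation[OF f b R e(1)] by metis
    have close: "\<bar>(\<integral>x. f x \<partial>M) - (\<integral>x. g x \<partial>M)\<bar> \<le> (2 * b + 2) * e"
      if M: "prob_space M" "sets M = sets borel" and tail: "measure M {x. norm x > R} \<le> e" for M
    proof -
      have "integrable M g"
        using integrable_Re[OF trig_sum_integrable[OF g(1) M]] by simp
      moreover have "\<bar>f x - g x\<bar> \<le> 2 * b + 1" for x
        using b[of x] g(3)[of x] e(2) by linarith
      ultimately have "\<bar>(\<integral>x. f x \<partial>M) - (\<integral>x. g x \<partial>M)\<bar> \<le> e + (2 * b + 1) * measure M {x. norm x > R}"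
        using e(1) g(2) by (intro integral_diff_le_tail[OF M f_int[OF M]]) auto
      also have "\<dots> \<le> e + (2 * b + 1) * e"
        using tail b0 by (intro add_left_mono mult_left_mono) auto
      finally show ?thesis
        by (simp add: algebra_simps)
    qed
    have "(\<lambda>n. CLINT x|\<mu> n. complex_of_real (g x)) \<longlonglongrightarrow> (CLINT x|\<nu>. complex_of_real (g x))"
      by (rule trig_sum_integral_tendsto[OF g(1) \<mu> \<nu> char])
    then have "(\<lambda>n. \<integral>x. g x \<partial>\<mu> n) \<longlonglongrightarrow> (\<integral>x. g x \<partial>\<nu>)"
      by (simp add: tendsto_of_real_iff)
    then obtain n0 where n0: "\<And>n. n \<ge> n0 \<Longrightarrow> \<bar>(\<integral>x. g x \<partial>\<mu> n) - (\<integral>x. g x \<partial>\<nu>)\<bar> < e"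
      using LIMSEQ_D[OF _ e(1)] by fastforce
    have "norm ((\<integral>x. f x \<partial>\<mu> n) - (\<integral>x. f x \<partial>\<nu>)) < r" if "n \<ge> n0" for n
    proof -
      have "\<bar>(\<integral>x. f x \<partial>\<mu> n) - (\<integral>x. g x \<partial>\<mu> n)\<bar> \<le> (2 * b + 2) * e"
        by (rule close[OF \<mu> shrink[OF \<mu> R2]]) (simp add: R_def)
      moreover have "\<bar>(\<integral>x. f x \<partial>\<nu>) - (\<integral>x. g x \<partial>\<nu>)\<bar> \<le> (2 * b + 2) * e"
        by (rule close[OF \<nu> shrink[OF \<nu> R1(2)]]) (simp add: R_def)
      moreover have "2 * ((2 * b + 2) * e) + e < e * (2 * (2 * b + 3))"
        using e(1) by (simp add: algebra_simps)
      ultimately show ?thesis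
        using n0[OF that] e(3) unfolding real_norm_def by linarith
    qed
    then show "\<exists>n0. \<forall>n\<ge>n0. norm ((\<integral>x. f x \<partial>\<mu> n) - (\<integral>x. f x \<partial>\<nu>)) < r"
      by blast
  qed
qed

section \<open>The multivariate central limit theorem\<close>

lemma (in prob_space) central_limit_theorem_char:
  fixes W :: "nat \<Rightarrow> 'a \<Rightarrow> real"
  assumes indep: "indep_vars (\<lambda>_. borel) W UNIV"
    and mean: "\<And>j. expectation (W j) = 0"
    and sq: "\<And>j. integrable M (\<lambda>\<omega>. (W j \<omega>)\<^sup>2)"
    and var: "\<And>j. expectation (\<lambda>\<omega>. (W j \<omega>)\<^sup>2) = v"
    and dist: "\<And>j. distr M borel (W j) = distr M borel (W 0)"
  shows "(\<lambda>n. CLINT \<omega>|M. iexp ((\<Sum>j<n. W j \<omega>) / sqrt n)) \<longlonglongrightarrow> complex_of_real (exp (- v / 2))"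
proof -
  have [measurable]: "W j \<in> borel_measurable M" for j
    using indep by (simp add: indep_vars_def)
  have v0: "v \<ge> 0"
    by (simp flip: var[of 0])
  show ?thesis
  proof (cases "v = 0")
    case True
    have "AE \<omega> in M. W j \<omega> = 0" for j
      using integral_nonneg_eq_0_iff_AE[OF sq[of j]] var[of j] True by simp
    then have "AE \<omega> in M. \<forall>j. W j \<omega> = 0"
      by (simp add: AE_all_countable)
    then have "(CLINT \<omega>|M. iexp ((\<Sum>j<n. W j \<omega>) / sqrt n)) = (CLINT \<omega>|M. 1)" for n
      by (intro integral_cong_AE) auto
    then show ?thesis
      by (simp add: True prob_space)
  next
    case False
    define \<sigma> where "\<sigma> = sqrt v"
    have \<sigma>: "\<sigma> > 0" "\<sigma>\<^sup>2 = v"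
      using v0 False by (simp_all add: \<sigma>_def)
    have "weak_conv_m (\<lambda>n. distr M borel (\<lambda>\<omega>. (\<Sum>j<n. W j \<omega>) / sqrt (n * \<sigma>\<^sup>2))) std_normal_distribution"
      using indep mean \<sigma>(1) sq _ dist by (rule central_limit_theorem_zero_mean) (simp add: mean var \<sigma>)
    then have "(\<lambda>n. char (distr M borel (\<lambda>\<omega>. (\<Sum>j<n. W j \<omega>) / sqrt (n * \<sigma>\<^sup>2))) \<sigma>)
        \<longlonglongrightarrow> char std_normal_distribution \<sigma>"
      by (intro levy_continuity1 real_dist_normal_dist real_distribution_distr) auto
    moreover have "char (distr M borel (\<lambda>\<omega>. (\<Sum>j<n. W j \<omega>) / sqrt (n * \<sigma>\<^sup>2))) \<sigma>
        = (CLINT \<omega>|M. iexp ((\<Sum>j<n. W j \<omega>) / sqrt n))" for n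
    proof -
      have "\<sigma> * (s / sqrt (n * \<sigma>\<^sup>2)) = s / sqrt n" for s
        using \<sigma>(1) by (simp add: real_sqrt_mult)
      then show ?thesis
        unfolding char_def by (subst integral_distr) (simp_all del: of_real_divide of_real_mult)
    qed
    ultimately show ?thesis
      by (simp add: char_std_normal_distribution \<sigma>)
  qed
qed

lemma (in prob_space) second_moment_sum_indep:
  fixes W :: "nat \<Rightarrow> 'a \<Rightarrow> real"
  assumes indep: "indep_vars (\<lambda>_. borel) W UNIV"
    and mean: "\<And>j. expectation (W j) = 0"
    and sq: "\<And>j. integrable M (\<lambda>\<omega>. (W j \<omega>)\<^sup>2)"
    and var: "\<And>j. expectation (\<lambda>\<omega>. (W j \<omega>)\<^sup>2) = v"
  shows "integrable M (\<lambda>\<omega>. (\<Sum>j<n. W j \<omega>)\<^sup>2)"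
    and "expectation (\<lambda>\<omega>. (\<Sum>j<n. W j \<omega>)\<^sup>2) = real n * v"
proof -
  have [measurable]: "W j \<in> borel_measurable M" for j
    using indep by (simp add: indep_vars_def)
  have int: "integrable M (W j)" for j
    by (rule square_integrable_imp_integrable[OF _ sq]) simp
  have prod: "integrable M (\<lambda>\<omega>. W i \<omega> * W j \<omega>) \<and>
      expectation (\<lambda>\<omega>. W i \<omega> * W j \<omega>) = (if i = j then v else 0)" for i j
  proof (cases "i = j")
    case True
    then show ?thesis
      using sq[of j] var[of j] by (simp add: power2_eq_square)
  next
    case False
    have "indep_vars (\<lambda>_. borel) W {i, j}"
      by (rule indep_vars_subset[OF indep]) simp
    from indep_vars_integrable[OF _ this] indep_vars_lebesgue_integral[OF _ this] show ?thesis
      using False int mean by simp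
  qed
  have eq: "(\<Sum>j<n. W j \<omega>)\<^sup>2 = (\<Sum>i<n. \<Sum>j<n. W i \<omega> * W j \<omega>)" for \<omega>
    by (simp add: power2_eq_square sum_product)
  show "integrable M (\<lambda>\<omega>. (\<Sum>j<n. W j \<omega>)\<^sup>2)"
    unfolding eq using prod by (intro Bochner_Integration.integrable_sum) blast
  have "expectation (\<lambda>\<omega>. (\<Sum>j<n. W j \<omega>)\<^sup>2) = (\<Sum>i<n. \<Sum>j<n. if i = j then v else 0)"
    unfolding eq using prod by (subst Bochner_Integration.integral_sum; simp)
  then show "expectation (\<lambda>\<omega>. (\<Sum>j<n. W j \<omega>)\<^sup>2) = real n * v"
    by (simp add: sum.delta)
qed

lemma (in prob_space) multivariate_central_limit_theorem:
  fixes W :: "nat \<Rightarrow> 'a \<Rightarrow> real ^ 'd::finite"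
  assumes indep: "indep_vars (\<lambda>_. borel) W UNIV"
    and dist: "\<And>j. distr M borel (W j) = distr M borel (W 0)"
    and sq: "integrable M (\<lambda>\<omega>. (norm (W 0 \<omega>))\<^sup>2)"
    and mean: "expectation (W 0) = 0"
  shows "\<exists>\<nu>. is_multivariate_normal \<nu> 0 (covariance_matrix M (W 0)) \<and>
    weakly_converges (\<lambda>n. distr M borel (\<lambda>\<omega>. (1 / sqrt (real n)) *\<^sub>R (\<Sum>j<n. W j \<omega>))) \<nu>"
proof -
  define \<Sigma> where "\<Sigma> = covariance_matrix M (W 0)"
  have W [measurable]: "W j \<in> borel_measurable M" for j
    using indep by (simp add: indep_vars_def)
  have dot_sq: "integrable M (\<lambda>\<omega>. (t \<bullet> W 0 \<omega>)\<^sup>2)" for t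
  proof (rule Bochner_Integration.integrable_bound)
    show "integrable M (\<lambda>\<omega>. (norm t)\<^sup>2 * (norm (W 0 \<omega>))\<^sup>2)"
      using sq by simp
    show "AE \<omega> in M. norm ((t \<bullet> W 0 \<omega>)\<^sup>2) \<le> norm ((norm t)\<^sup>2 * (norm (W 0 \<omega>))\<^sup>2)"
      using Cauchy_Schwarz_ineq2[of t] by (auto simp: power_mult_distrib[symmetric] abs_le_square_iff[symmetric])
  qed simp
  have "integrable M (\<lambda>\<omega>. norm (W 0 \<omega>))"
    by (rule square_integrable_imp_integrable[OF _ sq]) simp
  then have int: "integrable M (W 0)"
    by (simp add: integrable_norm_iff)
  have comp_mult: "integrable M (\<lambda>\<omega>. W 0 \<omega> $ i * W 0 \<omega> $ j)" for i j
  proof -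
    have "integrable M (\<lambda>\<omega>. (((axis i 1 + axis j 1) \<bullet> W 0 \<omega>)\<^sup>2 - ((axis i 1 - axis j 1) \<bullet> W 0 \<omega>)\<^sup>2) / 4)"
      using dot_sq by simp
    then show ?thesis
      by (simp add: inner_add_left inner_diff_left inner_axis' power2_eq_square algebra_simps)
  qed
  have \<Sigma>: "\<Sigma> $ i $ j = expectation (\<lambda>\<omega>. W 0 \<omega> $ i * W 0 \<omega> $ j)" for i j
    by (simp add: \<Sigma>_def covariance_matrix_def mean)
  have form: "t \<bullet> (\<Sigma> *v t) = expectation (\<lambda>\<omega>. (t \<bullet> W 0 \<omega>)\<^sup>2)" for t
  proof -
    have "expectation (\<lambda>\<omega>. (t \<bullet> W 0 \<omega>)\<^sup>2)
        = expectation (\<lambda>\<omega>. \<Sum>i\<in>UNIV. \<Sum>j\<in>UNIV. (t $ i * t $ j) * (W 0 \<omega> $ i * W 0 \<omega> $ j))"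
      by (simp add: inner_vec_def power2_eq_square sum_product mult_ac)
    also have "\<dots> = (\<Sum>i\<in>UNIV. \<Sum>j\<in>UNIV. (t $ i * t $ j) * \<Sigma> $ i $ j)"
      using comp_mult by (simp add: Bochner_Integration.integral_sum \<Sigma>)
    also have "\<dots> = t \<bullet> (\<Sigma> *v t)"
      by (simp add: inner_vec_def matrix_vector_mult_def sum_distrib_left mult_ac)
    finally show ?thesis
      by simp
  qed
  have sym: "transpose \<Sigma> = \<Sigma>"
    by (simp add: vec_eq_iff transpose_def \<Sigma> mult.commute)
  have psd: "t \<bullet> (\<Sigma> *v t) \<ge> 0" for t
    by (simp add: form)
  obtain \<nu> where \<nu>: "is_multivariate_normal \<nu> 0 \<Sigma>"
      "\<And>t. distr \<nu> borel (\<lambda>x. t \<bullet> x) = normal_law 0 (sqrt (t \<bullet> (\<Sigma> *v t)))"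
    by (rule multivariate_normal_exists[OF sym psd]) blast
  have prob_\<nu>: "prob_space \<nu>" and sets_\<nu> [measurable_cong]: "sets \<nu> = sets borel"
    using \<nu>(1) by (auto simp: is_multivariate_normal_def gaussian_law_def)
  have char_\<nu>: "(CLINT x|\<nu>. iexp (t \<bullet> x)) = exp (- (t \<bullet> (\<Sigma> *v t)) / 2)" for t
  proof -
    have "(CLINT x|\<nu>. iexp (t \<bullet> x)) = char (distr \<nu> borel (\<lambda>x. t \<bullet> x)) 1"
      unfolding char_def by (subst integral_distr) simp_all
    also have "\<dots> = char std_normal_distribution (sqrt (t \<bullet> (\<Sigma> *v t)))"
      unfolding \<nu>(2) using psd[of t] by (simp add: normal_law_zero_mean char_def integral_distr)
    also have "\<dots> = exp (- (t \<bullet> (\<Sigma> *v t)) / 2)"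
      using psd[of t] by (simp add: char_std_normal_distribution)
    finally show ?thesis .
  qed
  define Z where "Z n \<omega> = (1 / sqrt (real n)) *\<^sub>R (\<Sum>j<n. W j \<omega>)" for n \<omega>
  have Z [measurable]: "Z n \<in> borel_measurable M" for n
    unfolding Z_def by measurable
  have dot_Z: "t \<bullet> Z n \<omega> = (\<Sum>j<n. t \<bullet> W j \<omega>) / sqrt n" for t n \<omega>
    by (simp add: Z_def inner_sum_right)
  have dot_indep: "indep_vars (\<lambda>_. borel) (\<lambda>j \<omega>. t \<bullet> W j \<omega>) UNIV" for t
    by (rule indep_vars_compose2[OF indep]) simp
  have dot_dist: "distr M borel (\<lambda>\<omega>. t \<bullet> W j \<omega>) = distr M borel (\<lambda>\<omega>. t \<bullet> W 0 \<omega>)" for t j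
  proof -
    have "distr M borel (\<lambda>\<omega>. t \<bullet> W j \<omega>) = distr (distr M borel (W j)) borel (\<lambda>x. t \<bullet> x)" for j
      by (simp add: distr_distr comp_def)
    then show ?thesis
      using dist by metis
  qed
  have same: "integrable M (\<lambda>\<omega>. h (t \<bullet> W j \<omega>)) \<longleftrightarrow> integrable M (\<lambda>\<omega>. h (t \<bullet> W 0 \<omega>))"
    "expectation (\<lambda>\<omega>. h (t \<bullet> W j \<omega>)) = expectation (\<lambda>\<omega>. h (t \<bullet> W 0 \<omega>))"
    if h: "h \<in> borel_measurable borel" for h :: "real \<Rightarrow> real" and t j
  proof -
    have m: "(\<lambda>\<omega>. t \<bullet> W j \<omega>) \<in> borel_measurable M" for j
      by simp
    show "integrable M (\<lambda>\<omega>. h (t \<bullet> W j \<omega>)) \<longleftrightarrow> integrable M (\<lambda>\<omega>. h (t \<bullet> W 0 \<omega>))"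
      using integrable_distr_eq[OF m h] dot_dist by metis
    show "expectation (\<lambda>\<omega>. h (t \<bullet> W j \<omega>)) = expectation (\<lambda>\<omega>. h (t \<bullet> W 0 \<omega>))"
      using integral_distr[OF m h] dot_dist by metis
  qed
  have dot_mean: "expectation (\<lambda>\<omega>. t \<bullet> W j \<omega>) = 0" for t j
    using same(2)[of "\<lambda>x. x" t j] int mean by simp
  have dot_sq': "integrable M (\<lambda>\<omega>. (t \<bullet> W j \<omega>)\<^sup>2)" for t j
    using same(1)[of "\<lambda>x. x\<^sup>2" t j] dot_sq by simp
  have dot_var: "expectation (\<lambda>\<omega>. (t \<bullet> W j \<omega>)\<^sup>2) = t \<bullet> (\<Sigma> *v t)" for t j
    using same(2)[of "\<lambda>x. x\<^sup>2" t j] form by simp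
  have "weakly_converges (\<lambda>n. distr M borel (Z n)) \<nu>"
  proof (rule weakly_converges_if_char_tendsto[OF _ _ prob_\<nu> sets_\<nu>])
    show "prob_space (distr M borel (Z n))" "sets (distr M borel (Z n)) = sets borel" for n
      by (auto intro: prob_space_distr)
    show "(\<lambda>n. CLINT x|distr M borel (Z n). iexp (t \<bullet> x)) \<longlonglongrightarrow> (CLINT x|\<nu>. iexp (t \<bullet> x))" for t
    proof -
      have "(CLINT x|distr M borel (Z n). iexp (t \<bullet> x)) = (CLINT \<omega>|M. iexp ((\<Sum>j<n. t \<bullet> W j \<omega>) / sqrt n))" for n
        unfolding dot_Z[symmetric] by (rule integral_distr) simp_all
      then show ?thesis
        using central_limit_theorem_char[OF dot_indep dot_mean dot_sq' dot_var dot_dist, of t]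
        by (simp only: char_\<nu>)
    qed
    fix e :: real
    assume e: "e > 0"
    define K where "K = (\<Sum>i\<in>UNIV. axis i 1 \<bullet> (\<Sigma> *v axis i 1))"
    have K: "K \<ge> 0"
      by (simp add: K_def psd sum_nonneg)
    have Z2: "integrable M (\<lambda>\<omega>. (norm (Z n \<omega>))\<^sup>2) \<and> expectation (\<lambda>\<omega>. (norm (Z n \<omega>))\<^sup>2) \<le> K" for n
    proof -
      have norm_Z: "(norm (Z n \<omega>))\<^sup>2 = (\<Sum>i\<in>UNIV. (\<Sum>j<n. axis i 1 \<bullet> W j \<omega>)\<^sup>2 / n)" for \<omega>
      proof -
        have "(norm (Z n \<omega>))\<^sup>2 = (\<Sum>i\<in>UNIV. (axis i 1 \<bullet> Z n \<omega>)\<^sup>2)"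
          unfolding power2_norm_eq_inner
          by (simp add: inner_vec_def[of "Z n \<omega>"] inner_axis' power2_eq_square)
        then show ?thesis
          by (simp add: dot_Z power_divide)
      qed
      note moments = second_moment_sum_indep[OF dot_indep dot_mean dot_sq' dot_var]
      have "integrable M (\<lambda>\<omega>. (norm (Z n \<omega>))\<^sup>2)"
        unfolding norm_Z using moments(1) by (intro Bochner_Integration.integrable_sum integrable_divide_zero) blast
      moreover have "expectation (\<lambda>\<omega>. (norm (Z n \<omega>))\<^sup>2) = (\<Sum>i\<in>UNIV. real n * (axis i 1 \<bullet> (\<Sigma> *v axis i 1)) / n)"
        unfolding norm_Z using moments by (subst Bochner_Integration.integral_sum) simp_all
      moreover have "\<dots> \<le> K"
        unfolding K_def by (intro sum_mono) (simp add: psd)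
      ultimately show ?thesis
        by simp
    qed
    define R where "R = sqrt ((K + 1) / e)"
    have R: "R > 0" "R\<^sup>2 = (K + 1) / e"
      using K e by (simp_all add: R_def)
    have "measure (distr M borel (Z n)) {x. norm x > R} \<le> e" for n
    proof -
      have "measure (distr M borel (Z n)) {x. norm x > R} = prob {\<omega> \<in> space M. norm (Z n \<omega>) > R}"
        by (subst measure_distr) (auto intro!: arg_cong[where f = prob])
      also have "\<dots> \<le> prob {\<omega> \<in> space M. (norm (Z n \<omega>))\<^sup>2 \<ge> R\<^sup>2}"
        using R(1) by (intro finite_measure_mono) (auto intro!: power_mono)
      also have "\<dots> \<le> expectation (\<lambda>\<omega>. (norm (Z n \<omega>))\<^sup>2) / R\<^sup>2"
        using Z2 R(1) by (intro integral_Markov_inequality_measure[where A = "{}"]) auto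
      also have "\<dots> \<le> K / R\<^sup>2"
        using Z2 by (intro divide_right_mono) auto
      also have "\<dots> \<le> e"
        unfolding R(2) using K e by (simp add: field_simps)
      finally show ?thesis .
    qed
    then show "\<exists>R. \<forall>n. measure (distr M borel (Z n)) {x. norm x > R} \<le> e"
      by blast
  qed
  then show ?thesis
    using \<nu>(1) unfolding \<Sigma>_def Z_def[abs_def] by blast
qed

section \<open>Coordinates and covariances\<close>

lemma orthonormal_basis_expansion:
  assumes "orthonormal_basis_of F T" "v \<in> T"
  shows "v = (\<Sum>i\<in>UNIV. (v \<bullet> F i) *\<^sub>R F i)"
proof -
  have on: "F i \<bullet> F j = (if i = j then 1 else 0)" for i j
    using assms(1) by (simp add: orthonormal_basis_of_def)
  have "span (range F) \<subseteq> {v. v = (\<Sum>i\<in>UNIV. (v \<bullet> F i) *\<^sub>R F i)}"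
  proof (rule span_minimal)
    have "F j = (\<Sum>i\<in>UNIV. (F j \<bullet> F i) *\<^sub>R F i)" for j
      by (simp add: on if_distrib[of "\<lambda>r. r *\<^sub>R _"] cong: if_cong)
    then show "range F \<subseteq> {v. v = (\<Sum>i\<in>UNIV. (v \<bullet> F i) *\<^sub>R F i)}"
      by blast
    have "linear (\<lambda>v. v - (\<Sum>i\<in>UNIV. (v \<bullet> F i) *\<^sub>R F i))"
      by (intro linearI)
         (simp_all add: inner_add_left scaleR_add_left sum.distrib scaleR_sum_right scaleR_diff_right)
    from linear_subspace_kernel[OF this]
    show "subspace {v. v = (\<Sum>i\<in>UNIV. (v \<bullet> F i) *\<^sub>R F i)}"
      by simp
  qed
  then show ?thesis
    using assms by (auto simp: orthonormal_basis_of_def)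
qed

lemma orthonormal_basis_coords_unique:
  assumes "orthonormal_basis_of F T" "v = (\<Sum>i\<in>UNIV. c i *\<^sub>R F i)"
  shows "c i = v \<bullet> F i"
proof -
  have "F j \<bullet> F i = (if j = i then 1 else 0)" for j
    using assms(1) by (simp add: orthonormal_basis_of_def)
  then show ?thesis
    by (simp add: assms(2) inner_sum_left if_distrib[of "\<lambda>r. _ * r"] cong: if_cong)
qed

lemma coord_vec_orthonormal_basis:
  assumes "orthonormal_basis_of F T" "v \<in> T"
  shows "coord_vec F v = (\<chi> i. v \<bullet> F i)"
  unfolding coord_vec_def
proof (rule the_equality)
  show "v = (\<Sum>i\<in>UNIV. (\<chi> i. v \<bullet> F i) $ i *\<^sub>R F i)"
    using orthonormal_basis_expansion[OF assms] by simp
  show "c = (\<chi> i. v \<bullet> F i)" if "v = (\<Sum>i\<in>UNIV. c $ i *\<^sub>R F i)" for c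
    using orthonormal_basis_coords_unique[OF assms(1) that] by (simp add: vec_eq_iff)
qed

lemma continuous_map_borel_of_measurable:
  fixes J :: "'a \<Rightarrow> 'b::topological_space"
  assumes "continuous_map M euclidean J"
  shows "J \<in> borel_measurable (borel_of M)"
proof (rule borel_measurableI)
  fix U :: "'b set"
  assume "open U"
  have sub: "{U. openin M U} \<subseteq> Pow (topspace M)"
    using openin_subset by auto
  have "openin M {x \<in> topspace M. J x \<in> U}"
    using assms \<open>open U\<close> by (simp add: openin_continuous_map_preimage)
  moreover have "J -` U \<inter> space (borel_of M) = {x \<in> topspace M. J x \<in> U}"
    using sub by (auto simp: borel_of_def space_measure_of_conv)
  ultimately show "J -` U \<inter> space (borel_of M) \<in> sets (borel_of M)"
    using sub by (simp add: borel_of_def sets_measure_of sigma_sets.Basic)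
qed

lemma (in prob_space) covariance_matrix_affine_image:
  fixes Y :: "'a \<Rightarrow> real ^ 'n::finite" and A :: "real ^ 'n ^ 'd::finite"
  assumes [measurable]: "Y \<in> borel_measurable M" and sq: "integrable M (\<lambda>\<omega>. (norm (Y \<omega>))\<^sup>2)"
  shows "covariance_matrix M (\<lambda>\<omega>. A *v (Y \<omega> - c)) = A ** covariance_matrix M Y ** transpose A"
proof -
  define m where "m = expectation Y"
  define D where "D \<omega> = Y \<omega> - m" for \<omega>
  have [measurable]: "(\<lambda>x. x $ k) \<in> borel_measurable (borel :: (real ^ 'n) measure)" for k
    by (intro borel_measurable_continuous_onI continuous_intros)
  have [measurable]: "D \<in> borel_measurable M"
    unfolding D_def by measurable
  have "integrable M (\<lambda>\<omega>. norm (Y \<omega>))"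
    by (rule square_integrable_imp_integrable[OF _ sq]) simp
  then have int: "integrable M Y"
    by (simp add: integrable_norm_iff)
  have prod: "integrable M (\<lambda>\<omega>. D \<omega> $ k * D \<omega> $ l)" for k l
  proof (rule Bochner_Integration.integrable_bound)
    show "integrable M (\<lambda>\<omega>. 2 * (norm (Y \<omega>))\<^sup>2 + 2 * (norm m)\<^sup>2)"
      using sq by simp
    have "\<bar>D \<omega> $ k * D \<omega> $ l\<bar> \<le> 2 * (norm (Y \<omega>))\<^sup>2 + 2 * (norm m)\<^sup>2" for \<omega>
    proof -
      have "\<bar>D \<omega> $ k * D \<omega> $ l\<bar> \<le> norm (D \<omega>) * norm (D \<omega>)"
        unfolding abs_mult by (intro mult_mono component_le_norm_cart) auto
      also have "\<dots> \<le> (norm (Y \<omega>) + norm m) * (norm (Y \<omega>) + norm m)"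
        unfolding D_def by (intro mult_mono norm_triangle_ineq4) auto
      also have "\<dots> \<le> 2 * (norm (Y \<omega>))\<^sup>2 + 2 * (norm m)\<^sup>2"
        using sum_squares_bound[of "norm (Y \<omega>)" "norm m"] by (simp add: power2_eq_square algebra_simps)
      finally show ?thesis .
    qed
    then show "AE \<omega> in M. norm (D \<omega> $ k * D \<omega> $ l) \<le> norm (2 * (norm (Y \<omega>))\<^sup>2 + 2 * (norm m)\<^sup>2)"
      by (simp add: abs_mult)
  qed simp
  have "expectation (\<lambda>\<omega>. A *v (Y \<omega> - c)) = A *v expectation (\<lambda>\<omega>. Y \<omega> - c)"
    using int by (intro integral_bounded_linear matrix_vector_mul_bounded_linear) simp
  also have "\<dots> = A *v (m - c)"
    using int by (simp add: m_def prob_space)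
  finally have "A *v (Y \<omega> - c) - expectation (\<lambda>\<omega>. A *v (Y \<omega> - c)) = A *v D \<omega>" for \<omega>
    by (simp add: D_def matrix_vector_mult_diff_distrib)
  then have centred: "(A *v (Y \<omega> - c)) $ i - expectation (\<lambda>\<omega>. A *v (Y \<omega> - c)) $ i
      = (\<Sum>k\<in>UNIV. A $ i $ k * D \<omega> $ k)" for \<omega> i
    unfolding vector_minus_component[symmetric] by (simp add: matrix_vector_mult_def[of A "D \<omega>"])
  have cov: "covariance_matrix M Y $ k $ l = expectation (\<lambda>\<omega>. D \<omega> $ k * D \<omega> $ l)" for k l
    by (simp add: covariance_matrix_def D_def m_def)
  have "covariance_matrix M (\<lambda>\<omega>. A *v (Y \<omega> - c)) $ i $ j = (A ** covariance_matrix M Y ** transpose A) $ i $ j" for i j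
  proof -
    have "covariance_matrix M (\<lambda>\<omega>. A *v (Y \<omega> - c)) $ i $ j
        = expectation (\<lambda>\<omega>. \<Sum>k\<in>UNIV. \<Sum>l\<in>UNIV. (A $ i $ k * A $ j $ l) * (D \<omega> $ k * D \<omega> $ l))"
      unfolding covariance_matrix_def by (simp add: centred sum_product mult_ac)
    also have "\<dots> = (\<Sum>k\<in>UNIV. \<Sum>l\<in>UNIV. (A $ i $ k * A $ j $ l) * covariance_matrix M Y $ k $ l)"
      using prod by (simp add: Bochner_Integration.integral_sum cov)
    also have "\<dots> = (\<Sum>l\<in>UNIV. \<Sum>k\<in>UNIV. (A $ i $ k * A $ j $ l) * covariance_matrix M Y $ k $ l)"
      by (rule sum.swap)
    also have "\<dots> = (A ** covariance_matrix M Y ** transpose A) $ i $ j"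
      by (simp add: matrix_matrix_mult_def transpose_def sum_distrib_left mult_ac)
    finally show ?thesis .
  qed
  then show ?thesis
    by (simp add: vec_eq_iff)
qed

section \<open>The limit law of the projected sample mean\<close>

theorem proposition4p3:
  fixes k :: enat
    and M :: "'a topology"
    and A :: "('a, 'd::finite) chart set"
    and J :: "'a \<Rightarrow> real ^ 'n::finite"
    and Q :: "'a measure"
    and S :: "'w measure"
    and X :: "nat \<Rightarrow> 'w \<Rightarrow> 'a"
    and Y :: "nat \<Rightarrow> 'w \<Rightarrow> real ^ 'n"
    and Ybar :: "nat \<Rightarrow> 'w \<Rightarrow> real ^ 'n"
    and m :: "real ^ 'n"
    and P dP :: "real ^ 'n \<Rightarrow> real ^ 'n"
    and V :: "(real ^ 'n) set"
    and F :: "'d \<Rightarrow> real ^ 'n"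
    and C :: "real ^ 'n ^ 'n"
  assumes "k \<ge> 1"
    and "Ck_manifold k M A"
    and "Ck_embedding k M A J"
    and "closed (J ` topspace M)"
    and "prob_space Q" and "sets Q = sets (borel_of M)"
    and "prob_space S"
    and "prob_space.indep_vars S (\<lambda>_. Q) X UNIV"
    and "\<And>j. distr S Q (X j) = Q"
    and "\<And>j \<omega>. Y j \<omega> = J (X j \<omega>)"
    and "\<And>n \<omega>. Ybar n \<omega> = (1 / real n) *\<^sub>R (\<Sum>j<n. Y j \<omega>)"
    and "integrable S (\<lambda>\<omega>. (norm (Y 0 \<omega>))\<^sup>2)"
    and "m = (\<integral>\<omega>. Y 0 \<omega> \<partial>S)"
    and "P = closest_point (J ` topspace M)"
    and "open V" and "m \<in> V"
    and "unique_closest_point_on (J ` topspace M) V"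
    and "Ck_on 1 P V"
    and "dP = frechet_derivative P (at m)"
    and "orthonormal_basis_of F (image_tangent_space A J (P m))"
    and "C = covariance_matrix S (Y 0)"
  shows "(\<exists>!B :: real ^ 'd ^ 'n. \<forall>j. dP (axis j 1) = (\<Sum>i\<in>UNIV. B $ j $ i *\<^sub>R F i)) \<and>
    (\<forall>B :: real ^ 'd ^ 'n. (\<forall>j. dP (axis j 1) = (\<Sum>i\<in>UNIV. B $ j $ i *\<^sub>R F i)) \<longrightarrow>
      (\<exists>\<nu>. is_multivariate_normal \<nu> 0 (transpose B ** C ** B) \<and>
        weakly_converges
          (\<lambda>n. distr S borel (\<lambda>\<omega>. coord_vec F (sqrt (real n) *\<^sub>R dP (Ybar n \<omega> - m)))) \<nu>))"
proof -
  interpret S: prob_space S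
    by fact
  let ?T = "image_tangent_space A J (P m)"
  note on = \<open>orthonormal_basis_of F ?T\<close>

  have "n_times_cont_diff_on (Suc 0) P V"
    using \<open>Ck_on 1 P V\<close> by (auto simp: Ck_on_def one_enat_def)
  then have "P differentiable (at m)"
    using \<open>m \<in> V\<close> by simp
  then have dP: "(P has_derivative dP) (at m)"
    by (simp add: \<open>dP = _\<close> frechet_derivative_works)
  then have lin: "linear dP"
    by (rule has_derivative_linear)
  have "\<exists>p. p \<in> J ` topspace M"
    using \<open>unique_closest_point_on (J ` topspace M) V\<close> \<open>m \<in> V\<close> unfolding unique_closest_point_on_def by blast
  then have "P y \<in> J ` topspace M" for y
    unfolding \<open>P = _\<close> by (intro closest_point_in_set assms(4)) blast
  then have dP_T: "dP v \<in> ?T" for v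
    by (intro derivative_in_image_tangent_space[OF assms(1-3) dP]) simp
  have T: "subspace ?T"
    using on subspace_span unfolding orthonormal_basis_of_def by metis

  have "\<exists>!B :: real ^ 'd ^ 'n. \<forall>j. dP (axis j 1) = (\<Sum>i\<in>UNIV. B $ j $ i *\<^sub>R F i)"
  proof (rule ex1I)
    show "\<forall>j. dP (axis j 1) = (\<Sum>i\<in>UNIV. (\<chi> j i. dP (axis j 1) \<bullet> F i) $ j $ i *\<^sub>R F i)"
      using orthonormal_basis_expansion[OF on dP_T] by simp
    show "B = (\<chi> j i. dP (axis j 1) \<bullet> F i)" if "\<forall>j. dP (axis j 1) = (\<Sum>i\<in>UNIV. B $ j $ i *\<^sub>R F i)" for B
      using orthonormal_basis_coords_unique[OF on that[rule_format]] by (simp add: vec_eq_iff)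
  qed
  moreover have "\<exists>\<nu>. is_multivariate_normal \<nu> 0 (transpose B ** C ** B) \<and>
        weakly_converges
          (\<lambda>n. distr S borel (\<lambda>\<omega>. coord_vec F (sqrt (real n) *\<^sub>R dP (Ybar n \<omega> - m)))) \<nu>"
    if B: "\<forall>j. dP (axis j 1) = (\<Sum>i\<in>UNIV. B $ j $ i *\<^sub>R F i)" for B :: "real ^ 'd ^ 'n"
  proof -
    have Bji: "B $ j $ i = dP (axis j 1) \<bullet> F i" for i j
      using orthonormal_basis_coords_unique[OF on B[rule_format]] .
    have coord: "coord_vec F (r *\<^sub>R dP y) = r *\<^sub>R (transpose B *v y)" for r y
    proof -
      have "dP y = dP (\<Sum>j\<in>UNIV. y $ j *\<^sub>R axis j 1)"
        using basis_expansion[of y] by (simp add: scalar_mult_eq_scaleR)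
      also have "\<dots> = (\<Sum>j\<in>UNIV. y $ j *\<^sub>R dP (axis j 1))"
        using lin by (simp add: linear_sum linear_scale)
      finally have "dP y \<bullet> F i = (transpose B *v y) $ i" for i
        by (simp add: inner_sum_left Bji matrix_vector_mult_def transpose_def mult.commute)
      moreover have "r *\<^sub>R dP y \<in> ?T"
        using T dP_T by (simp add: subspace_scale)
      ultimately show ?thesis
        by (simp add: coord_vec_orthonormal_basis[OF on] vec_eq_iff)
    qed
    define h where "h x = transpose B *v (J x - m)" for x
    define W where "W j \<omega> = transpose B *v (Y j \<omega> - m)" for j \<omega>
    have W_h: "W j = (\<lambda>\<omega>. h (X j \<omega>))" for j
      by (auto simp: W_def h_def assms(10))
    have X: "X j \<in> measurable S Q" for j
      using \<open>S.indep_vars (\<lambda>_. Q) X UNIV\<close> by (simp add: S.indep_vars_def)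
    have "continuous_map M euclidean J"
      using \<open>Ck_embedding k M A J\<close> unfolding Ck_embedding_def
      by (metis embedding_map_def homeomorphic_imp_continuous_map continuous_map_in_subtopology)
    then have J: "J \<in> borel_measurable Q"
      using continuous_map_borel_of_measurable measurable_cong_sets[OF \<open>sets Q = _\<close> refl] by blast
    have Y: "Y j \<in> borel_measurable S" for j
      using measurable_compose[OF X J] by (simp add: assms(10)[abs_def])
    have h: "h \<in> borel_measurable Q"
      unfolding h_def
      by (intro measurable_compose[OF borel_measurable_diff[OF J borel_measurable_const]]
          borel_measurable_continuous_onI linear_continuous_on matrix_vector_mul_bounded_linear)
    have "\<exists>\<nu>. is_multivariate_normal \<nu> 0 (covariance_matrix S (W 0)) \<and>
        weakly_converges (\<lambda>n. distr S borel (\<lambda>\<omega>. (1 / sqrt (real n)) *\<^sub>R (\<Sum>j<n. W j \<omega>))) \<nu>"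
    proof (rule S.multivariate_central_limit_theorem)
      show "S.indep_vars (\<lambda>_. borel) W UNIV"
        unfolding W_h[abs_def] by (rule S.indep_vars_compose2[OF \<open>S.indep_vars (\<lambda>_. Q) X UNIV\<close> h])
      have "distr S borel (W j) = distr Q borel h" for j
        using distr_distr[OF h X, of j] by (simp add: W_h assms(9) comp_def)
      then show "distr S borel (W j) = distr S borel (W 0)" for j
        by simp
      have "integrable S (\<lambda>\<omega>. norm (Y 0 \<omega>))"
        by (rule S.square_integrable_imp_integrable[OF measurable_compose[OF Y borel_measurable_norm] assms(12)])
      then have int: "integrable S (Y 0)"
        by (rule integrable_norm_cancel[OF _ Y])
      then have "S.expectation (W 0) = transpose B *v S.expectation (\<lambda>\<omega>. Y 0 \<omega> - m)"
        unfolding W_def by (intro integral_bounded_linear matrix_vector_mul_bounded_linear) simp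
      also have "S.expectation (\<lambda>\<omega>. Y 0 \<omega> - m) = 0"
        using int by (simp add: \<open>m = _\<close> S.prob_space)
      finally show "S.expectation (W 0) = 0"
        by simp
      obtain K where K: "\<And>x. norm (transpose B *v x) \<le> norm x * K" "K > 0"
        using bounded_linear.pos_bounded[OF matrix_vector_mul_bounded_linear] by metis
      show "integrable S (\<lambda>\<omega>. (norm (W 0 \<omega>))\<^sup>2)"
      proof (rule Bochner_Integration.integrable_bound)
        show "integrable S (\<lambda>\<omega>. K\<^sup>2 * (2 * (norm (Y 0 \<omega>))\<^sup>2 + 2 * (norm m)\<^sup>2))"
          using assms(12) by simp
        have "(\<lambda>\<omega>. h (X 0 \<omega>)) \<in> borel_measurable S"
          by (rule measurable_compose[OF X h])
        then show "(\<lambda>\<omega>. (norm (W 0 \<omega>))\<^sup>2) \<in> borel_measurable S"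
          by (simp add: W_h)
        have "(norm (W 0 \<omega>))\<^sup>2 \<le> K\<^sup>2 * (2 * (norm (Y 0 \<omega>))\<^sup>2 + 2 * (norm m)\<^sup>2)" for \<omega>
        proof -
          have "norm (W 0 \<omega>) \<le> (norm (Y 0 \<omega>) + norm m) * K"
            unfolding W_def using K by (meson mult_right_mono norm_triangle_ineq4 order.trans less_imp_le)
          then have "(norm (W 0 \<omega>))\<^sup>2 \<le> ((norm (Y 0 \<omega>) + norm m) * K)\<^sup>2"
            by (rule power_mono) simp
          also have "\<dots> = K\<^sup>2 * (norm (Y 0 \<omega>) + norm m)\<^sup>2"
            by (simp add: power_mult_distrib)
          also have "\<dots> \<le> K\<^sup>2 * (2 * (norm (Y 0 \<omega>))\<^sup>2 + 2 * (norm m)\<^sup>2)"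
            using sum_squares_bound[of "norm (Y 0 \<omega>)" "norm m"]
            by (intro mult_left_mono) (simp_all add: power2_sum)
          finally show ?thesis .
        qed
        then show "AE \<omega> in S. norm ((norm (W 0 \<omega>))\<^sup>2) \<le> norm (K\<^sup>2 * (2 * (norm (Y 0 \<omega>))\<^sup>2 + 2 * (norm m)\<^sup>2))"
          by simp
      qed
    qed
    moreover have "covariance_matrix S (W 0) = transpose B ** C ** B"
      using S.covariance_matrix_affine_image[OF Y assms(12), of "transpose B" m]
      by (simp add: W_def[abs_def] \<open>C = _\<close>)
    moreover have "(1 / sqrt (real n)) *\<^sub>R (\<Sum>j<n. W j \<omega>) = coord_vec F (sqrt (real n) *\<^sub>R dP (Ybar n \<omega> - m))" for n \<omega>
    proof (cases "n = 0")
      case True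
      then show ?thesis
        using coord[of 0 0] by (simp add: linear_0[OF lin])
    next
      case False
      have "(\<Sum>j<n. W j \<omega>) = transpose B *v (\<Sum>j<n. Y j \<omega> - m)"
        by (simp add: W_def linear_sum[OF matrix_vector_mul_linear])
      also have "(\<Sum>j<n. Y j \<omega> - m) = real n *\<^sub>R (Ybar n \<omega> - m)"
        using False by (simp add: assms(11) sum_subtractf scaleR_diff_right sum_constant_scaleR del: sum_constant)
      finally have "(1 / sqrt (real n)) *\<^sub>R (\<Sum>j<n. W j \<omega>)
          = (real n / sqrt (real n)) *\<^sub>R (transpose B *v (Ybar n \<omega> - m))"
        by (simp add: matrix_vector_mult_scaleR)
      then show ?thesis
        by (simp add: coord real_div_sqrt)
    qed
    ultimately show ?thesis
      by simp
  qed
  ultimately show ?thesis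
    by blast
qed

end
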